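(* For every $0<\epsilon\le 1$ there exists an online algorithm for (integral) broadcast scheduling which, given $1+\epsilon$ resource augmentation, is $O(1/\epsilon^3)$-competitive for minimizing total flow time plus energy, for an arbitrary power function $P$ satisfying the standing assumptions below.
   Context: Broadcast scheduling with speed scaling: a single server stores $n$ pages; page $p$ has size $\sigma_p$. Requests arrive over time; $J_{p,i}$ denotes the $i$-th request for page $p$ and $a_{p,i}$ its arrival time. In the online setting the server learns of a request only at its arrival. At each time $t$ the server chooses a speed $s(t)\ge 0$ and which page to broadcast; broadcasting a page serves simultaneously all outstanding requests for that page. In the integral model a request $J_{p,i}$ is satisfied once, after time $a_{p,i}$, it has received the $\sigma_p$ unit-size pieces of page $p$ in sequential order (from the start of the page to its end); $f_{p,i}$ denotes the time it is satisfied. The total flow time is $F=\sum_{p}\sum_i (f_{p,i}-a_{p,i})$, the energy is $E=\int_0^\infty P(s(t))\,dt$, and the objective is $G=F+E$. The power function $P$ is arbitrary subject to: $P$ is defined, continuous and differentiable at all speeds, $P(0)=0$, $P$ is strictly increasing, strictly convex and unbounded. Resource augmentation: an algorithm with $1+\epsilon$ resource augmentation pays power $P(\gamma)$ when broadcasting at rate $(1+\epsilon)\gamma$. It is $c$-competitive if on every request sequence its objective is at most $c$ times the objective of an optimal offline schedule (without augmentation). *)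

theory Defs
  imports "HOL-Analysis.Analysis"
begin

definition strictly_convex_on :: "real set \<Rightarrow> (real \<Rightarrow> real) \<Rightarrow> bool" where
  "strictly_convex_on I f \<longleftrightarrow> convex I \<and>
     (\<forall>x\<in>I. \<forall>y\<in>I. \<forall>u. x \<noteq> y \<longrightarrow> 0 < u \<longrightarrow> u < 1 \<longrightarrow>
        f ((1 - u) * x + u * y) < (1 - u) * f x + u * f y)"

definition power_function :: "(real \<Rightarrow> real) \<Rightarrow> bool" where
  "power_function P \<longleftrightarrow>
     continuous_on {0..} P \<and> P differentiable_on {0..} \<and> P 0 = 0 \<and>
     strict_mono_on {0..} P \<and> strictly_convex_on {0..} P \<and> \<not> bdd_above (P ` {0..})"

text \<open>
  The pages are the numbers below \<open>n\<close>; page \<open>p\<close> consists of the unit-size pieces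
  \<open>0, \<dots>, \<sigma> p - 1\<close>. The requests for page \<open>p\<close> are given by the sorted list \<open>R p\<close> of their
  arrival times, so that \<open>R p ! i\<close> is the arrival time of the \<open>i\<close>-th request for \<open>p\<close>
  (counted from 0; simultaneous requests are allowed).
\<close>

type_synonym requests = "nat \<Rightarrow> real list"

definition request_sequence :: "nat \<Rightarrow> requests \<Rightarrow> bool" where
  "request_sequence n R \<longleftrightarrow> (\<forall>p<n. sorted (R p) \<and> (\<forall>a\<in>set (R p). 0 \<le> a))"

text \<open>
  At each time a schedule chooses a broadcast rate and a transmission \<open>(p, k, m)\<close> to work
  on: the \<open>m\<close>-th transmission of piece \<open>k\<close> of page \<open>p\<close>. The index \<open>m\<close> tells apart repeated
  broadcasts of the same piece. A transmission may be preempted and resumed at any time;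
  work on it beyond the size 1 of the piece delivers nothing.
\<close>

type_synonym transmission = "nat \<times> nat \<times> nat"
type_synonym schedule = "real \<Rightarrow> real \<times> transmission"

abbreviation rate :: "schedule \<Rightarrow> real \<Rightarrow> real" where
  "rate S t \<equiv> fst (S t)"

abbreviation transmitted :: "schedule \<Rightarrow> real \<Rightarrow> transmission" where
  "transmitted S t \<equiv> snd (S t)"

definition feasible :: "nat \<Rightarrow> (nat \<Rightarrow> nat) \<Rightarrow> schedule \<Rightarrow> bool" where
  "feasible n \<sigma> S \<longleftrightarrow>
     rate S \<in> borel_measurable borel \<and>
     transmitted S \<in> measurable borel (count_space UNIV) \<and>
     (\<forall>t. 0 \<le> rate S t) \<and>
     (\<forall>t p k m. 0 < rate S t \<longrightarrow> transmitted S t = (p, k, m) \<longrightarrow> p < n \<and> k < \<sigma> p)"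

definition work :: "schedule \<Rightarrow> transmission \<Rightarrow> real \<Rightarrow> ennreal" where
  "work S j t = (\<integral>\<^sup>+u\<in>{u. 0 \<le> u \<and> u \<le> t \<and> transmitted S u = j}. ennreal (rate S u) \<partial>lborel)"

text \<open>
  A request for page \<open>p\<close> arriving at time \<open>a\<close> is satisfied by time \<open>f\<close> if, piece after piece,
  it has received entire transmissions: the transmission of piece \<open>k\<close> used by the request is
  begun and completed between \<open>v k\<close> and \<open>v (Suc k)\<close>.
\<close>

definition satisfied_by :: "(nat \<Rightarrow> nat) \<Rightarrow> schedule \<Rightarrow> nat \<Rightarrow> real \<Rightarrow> real \<Rightarrow> bool" where
  "satisfied_by \<sigma> S p a f \<longleftrightarrow>
     (\<exists>(v :: nat \<Rightarrow> real) (m :: nat \<Rightarrow> nat). v 0 = a \<and> v (\<sigma> p) \<le> f \<and>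
        (\<forall>k<\<sigma> p. v k \<le> v (Suc k) \<and>
           work S (p, k, m k) (v k) = 0 \<and> 1 \<le> work S (p, k, m k) (v (Suc k))))"

text \<open>The completion time is \<open>\<infinity>\<close> for a request that is never satisfied.\<close>

definition completion_time :: "(nat \<Rightarrow> nat) \<Rightarrow> schedule \<Rightarrow> nat \<Rightarrow> real \<Rightarrow> ereal" where
  "completion_time \<sigma> S p a = (INF f\<in>{f. satisfied_by \<sigma> S p a f}. ereal f)"

definition total_flow_time :: "nat \<Rightarrow> (nat \<Rightarrow> nat) \<Rightarrow> requests \<Rightarrow> schedule \<Rightarrow> ereal" where
  "total_flow_time n \<sigma> R S =
     (\<Sum>p<n. \<Sum>i<length (R p). completion_time \<sigma> S p (R p ! i) - ereal (R p ! i))"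

text \<open>
  Below, \<open>\<alpha>\<close> is the resource augmentation: broadcasting at rate \<open>\<alpha> * \<gamma>\<close> costs power \<open>P \<gamma>\<close>.
\<close>

definition energy :: "(real \<Rightarrow> real) \<Rightarrow> real \<Rightarrow> schedule \<Rightarrow> ennreal" where
  "energy P \<alpha> S = (\<integral>\<^sup>+t\<in>{0..}. ennreal (P (rate S t / \<alpha>)) \<partial>lborel)"

definition objective ::
    "nat \<Rightarrow> (nat \<Rightarrow> nat) \<Rightarrow> (real \<Rightarrow> real) \<Rightarrow> real \<Rightarrow> requests \<Rightarrow> schedule \<Rightarrow> ereal" where
  "objective n \<sigma> P \<alpha> R S = total_flow_time n \<sigma> R S + enn2ereal (energy P \<alpha> S)"

text \<open>An infimum, since for some \<open>P\<close> the optimum need not be attained.\<close>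

definition opt :: "nat \<Rightarrow> (nat \<Rightarrow> nat) \<Rightarrow> (real \<Rightarrow> real) \<Rightarrow> requests \<Rightarrow> ereal" where
  "opt n \<sigma> P R = (INF S\<in>{S. feasible n \<sigma> S}. objective n \<sigma> P 1 R S)"

definition arrived :: "requests \<Rightarrow> real \<Rightarrow> nat \<Rightarrow> real list" where
  "arrived R t p = filter (\<lambda>a. a \<le> t) (R p)"

definition online_algorithm :: "nat \<Rightarrow> (nat \<Rightarrow> nat) \<Rightarrow> (requests \<Rightarrow> schedule) \<Rightarrow> bool" where
  "online_algorithm n \<sigma> A \<longleftrightarrow>
     (\<forall>R. request_sequence n R \<longrightarrow> feasible n \<sigma> (A R)) \<and>
     (\<forall>R R' t. request_sequence n R \<longrightarrow> request_sequence n R' \<longrightarrow> 0 \<le> t \<longrightarrow>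
        (\<forall>p<n. arrived R t p = arrived R' t p) \<longrightarrow> A R t = A R' t)"

definition competitive ::
    "nat \<Rightarrow> (nat \<Rightarrow> nat) \<Rightarrow> (real \<Rightarrow> real) \<Rightarrow> real \<Rightarrow> real \<Rightarrow> (requests \<Rightarrow> schedule) \<Rightarrow> bool" where
  "competitive n \<sigma> P \<alpha> c A \<longleftrightarrow>
     (\<forall>R. request_sequence n R \<longrightarrow> objective n \<sigma> P \<alpha> R (A R) \<le> ereal c * opt n \<sigma> P R)"

end

(* A fractional schedule, run only virtually, divides the speed (1 + eps/3) P^-1(N) equally among the
   latest eps/12 of the N requests that are fractionally incomplete; the real schedule runs at speed
   (1 + eps) P^-1(N'), where N' also counts the requests not yet really satisfied, and broadcasts the
   page of the latest request that is fractionally complete but unsatisfied. So power equals N', and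
   everything reduces to bounding the integral of N'. Put w(k) = k / P^-1(k), a nondecreasing function
   with w(k) / k nonincreasing and w(k) s <= k + P(s).

   N against the optimum: a late share given to a request that the optimum has satisfied is charged,
   with weight about w(N), to the optimum's work on that page since the arrival. Weights at earlier
   times are no smaller, up to 1 - eps/12, and the shares still to be received by the requests
   for p present at any time add up to at most the size of p, so a unit of the optimum's work at time
   u is charged at most w(N(u)). This costs a factor O(1/eps^2).

   N' against N: every unit of real work, with weight w(N' - N), is charged injectively to a unit of
   fractional work on the same page done after the arrival of all requests now waiting, when w(N')
   was at least that weight. As P^-1(N') w(N' - N) >= N' - N and P^-1(N) w(N') <= N', the integral of
   (1 + eps) (N' - N) is at most that of (1 + eps/3) N', which costs a factor O(1/eps). *)

theory Submission
  imports Defs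
begin

section \<open>Power functions and requests\<close>

text \<open>The weight k / \<open>power_inverse P k\<close> is the energy spent per unit of work by
  a server whose power equals k. An arbitrary \<open>P\<close> gives no control over how power
  changes when the speed is scaled, so all comparisons are made through this price, for which
  convexity and \<open>P 0 = 0\<close> suffice. The obstacle of the integral model is the order of
  the pieces: a pass over a page that was begun before a request arrived is in general of no use to
  it. Fractional work has no such defect, since it helps every outstanding request for the page from
  any position on. Hence only the virtual schedule is compared with the optimum, and the real one
  only with the virtual one. The augmentation is divided between the two comparisons. Against the
  optimum, (1 + \<epsilon> / 3) (1 - \<epsilon> / 12) is at least 1 + \<epsilon> / 6, and the
  surplus \<epsilon> / 6 absorbs the charge that falls back on the algorithm's own cost. Against the
  virtual schedule, the gap between 1 + \<epsilon> and 1 + \<epsilon> / 3 does the same. The final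
  constant is 576 = 2 * 3 * 96, with 2 for flow time and energy, 3 from the second comparison and 96
  from the first.\<close>

definition power_inverse :: "(real \<Rightarrow> real) \<Rightarrow> real \<Rightarrow> real" where
  "power_inverse P y = (THE s. 0 \<le> s \<and> P s = y)"

context
  fixes P :: "real \<Rightarrow> real"
  assumes P: "power_function P"
begin

lemma power_function_zero: "P 0 = 0"
  using P by (simp add: power_function_def)

lemma power_function_less: "0 \<le> x \<Longrightarrow> x < y \<Longrightarrow> P x < P y"
  using P by (auto simp: power_function_def strict_mono_on_def)

lemma power_function_nonneg: "0 \<le> x \<Longrightarrow> 0 \<le> P x"
  using power_function_less[of 0 x] power_function_zero by (cases "x = 0") auto

lemma power_function_surj:
  assumes "0 \<le> y"
  shows "\<exists>s\<ge>0. P s = y"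
proof -
  have "\<not> bdd_above (P ` {0..})"
    using P by (simp add: power_function_def)
  then obtain s where s: "0 \<le> s" "y < P s"
    by (auto simp: bdd_above_def not_le)
  have "continuous_on {0..s} P"
    using P by (auto simp: power_function_def intro: continuous_on_subset)
  then show ?thesis
    using IVT'[of P 0 y s] power_function_zero assms s by auto
qed

lemma power_inverse:
  assumes "0 \<le> y"
  shows "0 \<le> power_inverse P y" "P (power_inverse P y) = y"
proof -
  obtain s where "0 \<le> s" "P s = y"
    using power_function_surj assms by blast
  have "u = s" if "0 \<le> u \<and> P u = y" for u
    using that \<open>0 \<le> s\<close> \<open>P s = y\<close> power_function_less[of u s] power_function_less[of s u]
    by (cases u s rule: linorder_cases) auto
  with \<open>0 \<le> s\<close> \<open>P s = y\<close> have "0 \<le> power_inverse P y \<and> P (power_inverse P y) = y"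
    unfolding power_inverse_def by (rule theI[of "\<lambda>s. 0 \<le> s \<and> P s = y", OF conjI])
  then show "0 \<le> power_inverse P y" "P (power_inverse P y) = y"
    by auto
qed

lemma power_inverse_mono:
  assumes "0 \<le> x" "x \<le> y"
  shows "power_inverse P x \<le> power_inverse P y"
  using assms power_inverse[of x] power_inverse[of y] power_function_less[of "power_inverse P y" "power_inverse P x"]
  by (cases "power_inverse P y < power_inverse P x") auto

lemma power_inverse_pos: "0 < y \<Longrightarrow> 0 < power_inverse P y"
  using power_inverse[of y] power_function_zero by (cases "power_inverse P y = 0") auto

text \<open>Convexity and \<open>P 0 = 0\<close>: the point \<open>x\<close> is the convex
  combination of 0 and \<open>y\<close> with coefficient \<open>x / y\<close>. This is monotonicity
  of the slope of chords through the origin, multiplied out.\<close>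

lemma power_function_slope:
  assumes "0 < x" "x \<le> y"
  shows "P x * y \<le> P y * x"
proof (cases "x = y")
  case False
  have "P ((1 - u) * a + u * b) < (1 - u) * P a + u * P b"
    if "0 \<le> a" "0 \<le> b" "a \<noteq> b" "0 < u" "u < 1" for a b u
    using P that unfolding power_function_def strictly_convex_on_def by simp
  from this[of 0 y "x / y"] have "P x < x / y * P y"
    using False assms power_function_zero by simp
  then show ?thesis
    using assms power_function_zero by (simp add: field_simps)
qed simp

lemma power_inverse_ratio_mono:
  assumes "0 < x" "x \<le> y"
  shows "x / power_inverse P x \<le> y / power_inverse P y"
  using power_function_slope[of "power_inverse P x" "power_inverse P y"] assms
    power_inverse_mono[of x y] power_inverse_pos[of x] power_inverse_pos[of y]
    power_inverse(2)[of x] power_inverse(2)[of y]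
  by (simp add: field_simps)

text \<open>A Young-type inequality. Up to the speed \<open>power_inverse P x\<close> the product is
  at most \<open>x\<close>; beyond it, the chord to \<open>s\<close> is at least as steep as the
  chord to that speed, so the product is at most \<open>P s\<close>.\<close>

lemma power_inverse_ratio_bound:
  assumes "0 < x" "0 \<le> s"
  shows "x / power_inverse P x * s \<le> x + P s"
proof (cases "s \<le> power_inverse P x")
  case True
  then have "x / power_inverse P x * s \<le> x"
    using assms power_inverse_pos[of x] by (simp add: field_simps)
  then show ?thesis
    using power_function_nonneg assms by fastforce
next
  case False
  then have "x / power_inverse P x * s \<le> P s"
    using power_function_slope[of "power_inverse P x" s] assms power_inverse_pos[of x] power_inverse(2)[of x]
    by (simp add: field_simps)
  then show ?thesis
    using assms by simp
qed

end

lemma exists_top_subset: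
  fixes f :: "'a \<Rightarrow> real"
  assumes "finite A" "k \<le> card A"
  shows "\<exists>L\<subseteq>A. card L = k \<and> (\<forall>x\<in>L. \<forall>y\<in>A - L. f y \<le> f x)"
  using assms(2)
proof (induction k)
  case 0
  then show ?case by (intro exI[of _ "{}"]) auto
next
  case (Suc k)
  then obtain L where L: "L \<subseteq> A" "card L = k" "\<forall>x\<in>L. \<forall>y\<in>A - L. f y \<le> f x"
    by auto
  have fin: "finite (f ` (A - L))" "finite L"
    using assms(1) L(1) finite_subset by auto
  have "A - L \<noteq> {}"
    using Suc.prems L(1,2) assms(1) by (metis Diff_eq_empty_iff Suc_n_not_le_n subset_antisym)
  then have "Max (f ` (A - L)) \<in> f ` (A - L)"
    using fin by (intro Max_in) auto
  then obtain z where z: "z \<in> A - L" "f z = Max (f ` (A - L))"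
    by auto
  then have "\<forall>y\<in>A - L. f y \<le> f z"
    using fin by auto
  then show ?case
    using L z fin by (intro exI[of _ "insert z L"]) auto
qed

section \<open>Requests as pairs of a page and a position, and the requests known at a given
  time\<close>

type_synonym request = "nat \<times> nat"

definition requests_of :: "nat \<Rightarrow> requests \<Rightarrow> request set" where
  "requests_of n R = {r. fst r < n \<and> snd r < length (R (fst r))}"

definition arrival :: "requests \<Rightarrow> request \<Rightarrow> real" where
  "arrival R r = R (fst r) ! snd r"

definition arrived_requests :: "nat \<Rightarrow> requests \<Rightarrow> real \<Rightarrow> request set" where
  "arrived_requests n R t = {r \<in> requests_of n R. arrival R r \<le> t}"

lemma finite_requests_of [simp]: "finite (requests_of n R)"
proof -
  have "requests_of n R = (SIGMA p:{..<n}. {..<length (R p)})"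
    by (auto simp: requests_of_def)
  then show ?thesis by simp
qed

lemma sum_requests_of:
  "(\<Sum>r\<in>requests_of n R. f (fst r) (snd r)) = (\<Sum>p<n. \<Sum>i<length (R p). f p i)"
proof -
  have "requests_of n R = (SIGMA p:{..<n}. {..<length (R p)})"
    by (auto simp: requests_of_def)
  then show ?thesis
    by (simp add: sum.Sigma case_prod_beta)
qed

lemma finite_arrived_requests [simp]: "finite (arrived_requests n R t)"
  by (simp add: arrived_requests_def)

text \<open>In a sorted list the entries up to \<open>t\<close> form an initial segment, so a
  request has the same position among the arrived requests as in the full list. This makes positions
  usable as names in the online setting.\<close>

lemma sorted_filter_le:
  fixes xs :: "real list"
  assumes "sorted xs" "i < length xs"
  shows "xs ! i \<le> t \<longleftrightarrow> i < length (filter (\<lambda>a. a \<le> t) xs)"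
    and "xs ! i \<le> t \<Longrightarrow> filter (\<lambda>a. a \<le> t) xs ! i = xs ! i"
proof -
  have eq: "takeWhile (\<lambda>a. a \<le> t) xs = filter (\<lambda>a. a \<le> t) xs"
  proof (rule takeWhile_eq_filter)
    fix x assume x: "x \<in> set (dropWhile (\<lambda>a. a \<le> t) xs)"
    then have ne: "dropWhile (\<lambda>a. a \<le> t) xs \<noteq> []" by (metis empty_iff empty_set)
    have "sorted (dropWhile (\<lambda>a. a \<le> t) xs)"
      using assms(1) sorted_dropWhile by blast
    moreover have "\<not> hd (dropWhile (\<lambda>a. a \<le> t) xs) \<le> t"
      using ne hd_dropWhile by blast
    ultimately show "\<not> x \<le> t"
      using x ne by (cases "dropWhile (\<lambda>a. a \<le> t) xs") auto
  qed
  have 1: "xs ! i \<le> t" if "i < length (takeWhile (\<lambda>a. a \<le> t) xs)"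
    using that nth_mem[OF that] set_takeWhileD takeWhile_nth by fastforce
  have 2: "i < length (takeWhile (\<lambda>a. a \<le> t) xs)" if "xs ! i \<le> t"
  proof (rule ccontr)
    let ?m = "length (takeWhile (\<lambda>a. a \<le> t) xs)"
    assume c: "\<not> i < ?m"
    then have "?m < length xs" using assms(2) by simp
    then have "\<not> xs ! ?m \<le> t" using nth_length_takeWhile by blast
    moreover have "xs ! ?m \<le> xs ! i" using c assms sorted_nth_mono by (metis not_less)
    ultimately show False using that by simp
  qed
  show "xs ! i \<le> t \<longleftrightarrow> i < length (filter (\<lambda>a. a \<le> t) xs)"
    using 1 2 eq by auto
  show "xs ! i \<le> t \<Longrightarrow> filter (\<lambda>a. a \<le> t) xs ! i = xs ! i"
    using 2 eq takeWhile_nth by metis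
qed

lemma arrived_requests_cong:
  assumes R: "request_sequence n R" "request_sequence n R'"
    and eq: "\<forall>p<n. arrived R t p = arrived R' t p" and "u \<le> t"
  shows "arrived_requests n R u = arrived_requests n R' u"
    and "r \<in> arrived_requests n R u \<Longrightarrow> arrival R r = arrival R' r"
proof -
  have *: "r \<in> arrived_requests n R' u \<and> arrival R r = arrival R' r"
    if r: "r \<in> arrived_requests n R u" and R: "request_sequence n R" "request_sequence n R'"
      and eq: "\<forall>p<n. arrived R t p = arrived R' t p" for r R R'
  proof -
    obtain p i where [simp]: "r = (p, i)" by (cases r)
    have pi: "p < n" "i < length (R p)" "R p ! i \<le> u"
      using r by (auto simp: arrived_requests_def requests_of_def arrival_def)
    have s: "sorted (R p)" "sorted (R' p)"
      using R pi by (auto simp: request_sequence_def)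
    have f: "filter (\<lambda>a. a \<le> t) (R p) = filter (\<lambda>a. a \<le> t) (R' p)"
      using eq pi by (auto simp: arrived_def)
    have le: "R p ! i \<le> t" using pi \<open>u \<le> t\<close> by simp
    then have 1: "i < length (filter (\<lambda>a. a \<le> t) (R' p))"
      using sorted_filter_le(1)[OF s(1) pi(2)] f by auto
    then have 2: "i < length (R' p)"
      by (meson length_filter_le order_less_le_trans)
    then have 3: "R' p ! i \<le> t"
      using sorted_filter_le(1)[OF s(2) 2] 1 by auto
    have "R p ! i = R' p ! i"
      using sorted_filter_le(2)[OF s(1) pi(2) le] sorted_filter_le(2)[OF s(2) 2 3] f by simp
    then show ?thesis
      using pi 2 by (auto simp: arrived_requests_def requests_of_def arrival_def)
  qed
  show "arrived_requests n R u = arrived_requests n R' u"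
    using *[OF _ R eq] *[OF _ R(2,1)] eq by (metis subsetI subset_antisym)
  show "r \<in> arrived_requests n R u \<Longrightarrow> arrival R r = arrival R' r"
    using *[OF _ R eq] by blast
qed

section \<open>Joint simulation of the fractional and the real schedule\<close>

text \<open>
  A state of the joint simulation. \<open>fwork p\<close> is the work the virtual fractional schedule has spent on
  page \<open>p\<close> and \<open>got r\<close> the part of it done since the arrival of \<open>r\<close>; the real schedule is inside
  transmission number \<open>index p\<close> of page \<open>p\<close>, which was begun at time \<open>start p\<close>, when \<open>fwork p\<close> was
  \<open>base p\<close>.
\<close>

datatype state = State
  (now: real) (fwork: "nat \<Rightarrow> real") (got: "request \<Rightarrow> real") (base: "nat \<Rightarrow> real")
  (progress: "nat \<Rightarrow> real") (start: "nat \<Rightarrow> real") (index: "nat \<Rightarrow> nat")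
  (satisfied: "request set")

text \<open>\<open>Q\<close> stands for the inverse of the power function. Construction and
  simulation rely on these properties alone; \<open>P\<close> itself returns only with the
  energy.\<close>

locale broadcast =
  fixes n :: nat and \<sigma> :: "nat \<Rightarrow> nat" and Q :: "real \<Rightarrow> real" and \<epsilon> :: real
  assumes eps: "0 < \<epsilon>" "\<epsilon> \<le> 1"
    and size_pos: "\<And>p. p < n \<Longrightarrow> 0 < \<sigma> p"
    and Q_nonneg: "\<And>x. 0 \<le> x \<Longrightarrow> 0 \<le> Q x"
    and Q_pos: "\<And>x. 0 < x \<Longrightarrow> 0 < Q x"
    and Q_mono: "\<And>x y. 0 \<le> x \<Longrightarrow> x \<le> y \<Longrightarrow> Q x \<le> Q y"
    and Q_ratio_mono: "\<And>x y. 0 < x \<Longrightarrow> x \<le> y \<Longrightarrow> x / Q x \<le> y / Q y"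
begin

definition alive :: "requests \<Rightarrow> state \<Rightarrow> request set" where
  "alive R s = {r \<in> arrived_requests n R (now s). got s r < \<sigma> (fst r)}"

definition pending :: "requests \<Rightarrow> state \<Rightarrow> request set" where
  "pending R s = {r \<in> arrived_requests n R (now s). got s r < \<sigma> (fst r) \<or> r \<notin> satisfied s}"

definition waiting :: "requests \<Rightarrow> state \<Rightarrow> request set" where
  "waiting R s = pending R s - alive R s"

text \<open>Rounding up keeps at least one late request as long as any request is alive; the price
  is an additive 1 in \<open>quota_le\<close>.\<close>

definition quota :: "requests \<Rightarrow> state \<Rightarrow> nat" where
  "quota R s = nat \<lceil>\<epsilon> / 12 * card (alive R s)\<rceil>"

text \<open>Ties are left to \<open>SOME\<close>. Its predicate depends only on the alive requests
  and their arrival times, so two request sequences with the same past yield the same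
  choice.\<close>

definition late :: "requests \<Rightarrow> state \<Rightarrow> request set" where
  "late R s = (SOME L. L \<subseteq> alive R s \<and> card L = quota R s \<and>
     (\<forall>x\<in>L. \<forall>y\<in>alive R s - L. arrival R y \<le> arrival R x))"

definition share :: "requests \<Rightarrow> state \<Rightarrow> real" where
  "share R s = (1 + \<epsilon> / 3) * Q (card (alive R s)) / quota R s"

text \<open>A page earns one share per late request, but the broadcast reaches everybody: in
  \<open>step\<close> each arrived request for the page, late or not, receives the full
  rate.\<close>

definition frate :: "requests \<Rightarrow> state \<Rightarrow> nat \<Rightarrow> real" where
  "frate R s p = share R s * card {r \<in> late R s. fst r = p}"

definition newest_waiting :: "requests \<Rightarrow> state \<Rightarrow> request" where
  "newest_waiting R s =
     (SOME r. r \<in> waiting R s \<and> (\<forall>r'\<in>waiting R s. arrival R r' \<le> arrival R r))"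

definition speed :: "requests \<Rightarrow> state \<Rightarrow> real" where
  "speed R s = (if waiting R s = {} then 0 else (1 + \<epsilon>) * Q (card (pending R s)))"

definition prate :: "requests \<Rightarrow> state \<Rightarrow> nat \<Rightarrow> real" where
  "prate R s p = (if p = fst (newest_waiting R s) then speed R s else 0)"

definition arrival_gaps :: "requests \<Rightarrow> state \<Rightarrow> real set" where
  "arrival_gaps R s =
     (\<lambda>r. arrival R r - now s) ` (requests_of n R - arrived_requests n R (now s))"

definition internal_gaps :: "requests \<Rightarrow> state \<Rightarrow> real set" where
  "internal_gaps R s =
     (\<lambda>r. (\<sigma> (fst r) - got s r) / frate R s (fst r)) ` {r \<in> alive R s. 0 < frate R s (fst r)} \<union>
     (if waiting R s = {} then {}
      else {(\<sigma> (fst (newest_waiting R s)) - progress s (fst (newest_waiting R s))) / speed R s})"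

definition gaps :: "requests \<Rightarrow> state \<Rightarrow> real set" where
  "gaps R s = arrival_gaps R s \<union> internal_gaps R s"

text \<open>All rates are constant between events, so the trajectory may jump from event to event.
  The value 0 when no event is left makes the clock stand still from then on.\<close>

definition duration :: "requests \<Rightarrow> state \<Rightarrow> real" where
  "duration R s = (if gaps R s = {} then 0 else Min (gaps R s))"

text \<open>This may include requests that are still fractionally alive; such a request stays in
  \<open>pending\<close> until its fractional completion.\<close>

definition served :: "requests \<Rightarrow> state \<Rightarrow> request set" where
  "served R s = {r \<in> arrived_requests n R (now s).
     \<sigma> (fst r) \<le> progress s (fst r) + prate R s (fst r) * duration R s \<and>
     arrival R r \<le> start s (fst r)}"

text \<open>
  A transmission is abandoned once the fractional schedule has, since its start, spent at least as
  much on the page as the real schedule. This keeps every waiting request covered by the current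
  transmission of its page, and it never lowers \<open>low_mark\<close> below.
\<close>

definition restart :: "requests \<Rightarrow> state \<Rightarrow> nat \<Rightarrow> bool" where
  "restart R s p \<longleftrightarrow> progress s p + prate R s p * duration R s
     \<le> fwork s p + frate R s p * duration R s - base s p"

definition step :: "requests \<Rightarrow> state \<Rightarrow> state" where
  "step R s = State
     (now s + duration R s)
     (\<lambda>p. fwork s p + frate R s p * duration R s)
     (\<lambda>r. got s r + (if r \<in> arrived_requests n R (now s) then frate R s (fst r) * duration R s else 0))
     (\<lambda>p. if restart R s p then fwork s p + frate R s p * duration R s else base s p)
     (\<lambda>p. if restart R s p then 0 else progress s p + prate R s p * duration R s)
     (\<lambda>p. if restart R s p then now s + duration R s else start s p)
     (\<lambda>p. if restart R s p then Suc (index s p) else index s p)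
     (satisfied s \<union> served R s)"

definition initial :: state where
  "initial = State 0 (\<lambda>p. 0) (\<lambda>r. 0) (\<lambda>p. 0) (\<lambda>p. 0) (\<lambda>p. 0) (\<lambda>p. 0) {}"

primrec trajectory :: "requests \<Rightarrow> nat \<Rightarrow> state" where
  "trajectory R 0 = initial"
| "trajectory R (Suc k) = step R (trajectory R k)"

section \<open>Rates, selections and the invariant of the simulation\<close>

lemma step_simps [simp]:
  "now (step R s) = now s + duration R s"
  "fwork (step R s) p = fwork s p + frate R s p * duration R s"
  "got (step R s) r =
     got s r + (if r \<in> arrived_requests n R (now s) then frate R s (fst r) * duration R s else 0)"
  "base (step R s) p = (if restart R s p then fwork s p + frate R s p * duration R s else base s p)"
  "progress (step R s) p = (if restart R s p then 0 else progress s p + prate R s p * duration R s)"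
  "start (step R s) p = (if restart R s p then now s + duration R s else start s p)"
  "index (step R s) p = (if restart R s p then Suc (index s p) else index s p)"
  "satisfied (step R s) = satisfied s \<union> served R s"
  by (simp_all add: step_def)

lemma initial_simps [simp]:
  "now initial = 0" "fwork initial p = 0" "got initial r = 0" "base initial p = 0"
  "progress initial p = 0" "start initial p = 0" "index initial p = 0" "satisfied initial = {}"
  by (simp_all add: initial_def)

lemma alive_subset: "alive R s \<subseteq> pending R s" "pending R s \<subseteq> arrived_requests n R (now s)"
  "waiting R s \<subseteq> pending R s"
  by (auto simp: alive_def pending_def waiting_def)

lemma finite_alive [simp]: "finite (alive R s)" "finite (pending R s)" "finite (waiting R s)"
  by (meson alive_subset finite_arrived_requests finite_subset)+

lemma waiting_iff:
  "r \<in> waiting R s \<longleftrightarrow>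
     r \<in> arrived_requests n R (now s) \<and> \<sigma> (fst r) \<le> got s r \<and> r \<notin> satisfied s"
  by (auto simp: waiting_def pending_def alive_def)

lemma card_pending: "card (pending R s) = card (alive R s) + card (waiting R s)"
  unfolding waiting_def using alive_subset(1) finite_alive
  by (metis card_Diff_subset card_mono le_add_diff_inverse)

lemma quota_ge: "\<epsilon> / 12 * card (alive R s) \<le> quota R s"
  unfolding quota_def by linarith

lemma quota_le: "quota R s \<le> \<epsilon> / 12 * card (alive R s) + 1"
proof -
  have "0 \<le> \<epsilon> / 12 * card (alive R s)"
    using eps by simp
  then show ?thesis
    unfolding quota_def by linarith
qed

lemma quota_le_card: "quota R s \<le> card (alive R s)"
proof -
  have "\<epsilon> / 12 * card (alive R s) \<le> 1 * real (card (alive R s))"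
    using eps by (intro mult_right_mono) auto
  then show ?thesis
    unfolding quota_def by linarith
qed

lemma quota_pos: "alive R s \<noteq> {} \<Longrightarrow> 0 < quota R s"
  using quota_ge[of R s] eps by (simp add: card_gt_0_iff quota_def)

lemma late:
  "late R s \<subseteq> alive R s" "card (late R s) = quota R s"
  "x \<in> late R s \<Longrightarrow> y \<in> alive R s - late R s \<Longrightarrow> arrival R y \<le> arrival R x"
proof -
  have "late R s \<subseteq> alive R s \<and> card (late R s) = quota R s \<and>
     (\<forall>x\<in>late R s. \<forall>y\<in>alive R s - late R s. arrival R y \<le> arrival R x)"
    unfolding late_def
    by (rule someI_ex) (use exists_top_subset[OF finite_alive(1) quota_le_card] in auto)
  then show "late R s \<subseteq> alive R s" "card (late R s) = quota R s"
    "x \<in> late R s \<Longrightarrow> y \<in> alive R s - late R s \<Longrightarrow> arrival R y \<le> arrival R x"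
    by auto
qed

lemma finite_late [simp]: "finite (late R s)"
  using late(1) finite_alive(1) finite_subset by blast

lemma share_nonneg: "0 \<le> share R s"
  unfolding share_def using eps Q_nonneg by simp

lemma share_pos: "alive R s \<noteq> {} \<Longrightarrow> 0 < share R s"
  unfolding share_def using eps Q_pos quota_pos by (simp add: card_gt_0_iff)

lemma frate_nonneg: "0 \<le> frate R s p"
  unfolding frate_def using share_nonneg by simp

lemma frate_pos:
  assumes "r \<in> late R s"
  shows "0 < frate R s (fst r)"
proof -
  have "r \<in> {r' \<in> late R s. fst r' = fst r}" "finite {r' \<in> late R s. fst r' = fst r}"
    using assms by auto
  then have "0 < card {r' \<in> late R s. fst r' = fst r}"
    by (metis card_gt_0_iff empty_iff)
  moreover have "alive R s \<noteq> {}"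
    using late(1) assms by blast
  ultimately show ?thesis
    unfolding frate_def by (intro mult_pos_pos share_pos) simp_all
qed

text \<open>If nothing is alive, \<open>quota\<close> is 0 and the division in \<open>share\<close>
  yields 0; the factor \<open>of_bool\<close> records this because \<open>Q 0\<close> need not be
  0.\<close>

lemma sum_frate: "(\<Sum>p<n. frate R s p) = (1 + \<epsilon> / 3) * Q (card (alive R s)) * of_bool (alive R s \<noteq> {})"
proof -
  have "late R s = (\<Union>p<n. {r \<in> late R s. fst r = p})"
    using late(1)[of R s] by (auto simp: alive_def arrived_requests_def requests_of_def)
  then have "card (late R s) = card (\<Union>p<n. {r \<in> late R s. fst r = p})"
    by (rule arg_cong)
  also have "\<dots> = (\<Sum>p<n. card {r \<in> late R s. fst r = p})"
    by (intro card_UN_disjoint) auto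
  finally have "quota R s = (\<Sum>p<n. card {r \<in> late R s. fst r = p})"
    by (simp add: late(2))
  then have "(\<Sum>p<n. real (card {r \<in> late R s. fst r = p})) = quota R s"
    by simp
  then have "(\<Sum>p<n. frate R s p) = share R s * quota R s"
    unfolding frate_def by (simp flip: sum_distrib_left)
  then show ?thesis
    using quota_pos[of R s] by (cases "alive R s = {}") (simp_all add: share_def quota_def)
qed

lemma newest_waiting:
  assumes "waiting R s \<noteq> {}"
  shows "newest_waiting R s \<in> waiting R s"
    and "r \<in> waiting R s \<Longrightarrow> arrival R r \<le> arrival R (newest_waiting R s)"
proof -
  have "Max (arrival R ` waiting R s) \<in> arrival R ` waiting R s"
    using assms by (intro Max_in) auto
  then obtain x where "x \<in> waiting R s" "arrival R x = Max (arrival R ` waiting R s)"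
    by auto
  then have "\<exists>x. x \<in> waiting R s \<and> (\<forall>r\<in>waiting R s. arrival R r \<le> arrival R x)"
    by (intro exI[of _ x]) auto
  then have "newest_waiting R s \<in> waiting R s \<and>
      (\<forall>r\<in>waiting R s. arrival R r \<le> arrival R (newest_waiting R s))"
    unfolding newest_waiting_def by (rule someI_ex)
  then show "newest_waiting R s \<in> waiting R s"
    "r \<in> waiting R s \<Longrightarrow> arrival R r \<le> arrival R (newest_waiting R s)"
    by auto
qed

lemma speed_nonneg: "0 \<le> speed R s"
  unfolding speed_def using eps Q_nonneg by simp

lemma speed_pos:
  assumes "waiting R s \<noteq> {}"
  shows "0 < speed R s"
proof -
  have "0 < card (pending R s)"
    using assms alive_subset(3)[of R s] by (metis card_gt_0_iff finite_alive(2) subset_empty)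
  then show ?thesis
    unfolding speed_def using assms eps Q_pos by simp
qed

lemma prate_nonneg: "0 \<le> prate R s p"
  unfolding prate_def using speed_nonneg by simp

text \<open>The disjunction is what restarting at the end of each step enforces: a transmission
  either is strictly ahead of the fractional work done on the page since its start, or has just
  begun. The last two clauses concern requests that arrived during the current transmission, which
  got at most that fractional work, and requests covered by a finished one.\<close>

definition invar :: "requests \<Rightarrow> state \<Rightarrow> bool" where
  "invar R s \<longleftrightarrow> 0 \<le> now s \<and> (\<forall>r. 0 \<le> got s r) \<and>
     (\<forall>r. r \<notin> arrived_requests n R (now s) \<longrightarrow> got s r = 0) \<and>
     (\<forall>p. 0 \<le> progress s p \<and> progress s p \<le> \<sigma> p \<and> 0 \<le> start s p \<and> start s p \<le> now s) \<and>
     (\<forall>p. 0 \<le> fwork s p - base s p \<and> (fwork s p - base s p < progress s p \<or>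
        fwork s p = base s p \<and> progress s p = 0)) \<and>
     (\<forall>r\<in>arrived_requests n R (now s). start s (fst r) < arrival R r \<longrightarrow>
        got s r \<le> fwork s (fst r) - base s (fst r)) \<and>
     (\<forall>r\<in>arrived_requests n R (now s). arrival R r \<le> start s (fst r) \<longrightarrow>
        progress s (fst r) = \<sigma> (fst r) \<longrightarrow> r \<in> satisfied s)"

text \<open>Had the request arrived after the start of the current transmission, it would have
  received less than \<open>progress\<close>, hence less than the whole page, and could not be
  fractionally complete. So continuing the current transmission always serves a waiting
  request.\<close>

lemma waiting_invar:
  assumes "invar R s" "r \<in> waiting R s"
  shows "arrival R r \<le> start s (fst r)" "progress s (fst r) < \<sigma> (fst r)"
proof -
  have r: "r \<in> arrived_requests n R (now s)" "\<sigma> (fst r) \<le> got s r" "r \<notin> satisfied s"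
    using assms(2) by (auto simp: waiting_iff)
  then have "fst r < n"
    by (auto simp: arrived_requests_def requests_of_def)
  then have pos: "0 < \<sigma> (fst r)"
    by (rule size_pos)
  have I: "0 \<le> progress s (fst r)" "progress s (fst r) \<le> \<sigma> (fst r)"
    "fwork s (fst r) - base s (fst r) < progress s (fst r) \<or>
      fwork s (fst r) = base s (fst r) \<and> progress s (fst r) = 0"
    "start s (fst r) < arrival R r \<Longrightarrow> got s r \<le> fwork s (fst r) - base s (fst r)"
    "arrival R r \<le> start s (fst r) \<Longrightarrow> progress s (fst r) = \<sigma> (fst r) \<Longrightarrow> r \<in> satisfied s"
    using assms(1) r(1) unfolding invar_def by auto
  show "arrival R r \<le> start s (fst r)"
  proof (rule ccontr)
    assume "\<not> ?thesis"
    then have "\<sigma> (fst r) \<le> fwork s (fst r) - base s (fst r)"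
      using I(4) r(2) by simp
    then show False
      using I(2,3) pos by auto
  qed
  then show "progress s (fst r) < \<sigma> (fst r)"
    using I r(3) by (cases "progress s (fst r) = \<sigma> (fst r)") auto
qed

lemma finite_gaps [simp]: "finite (gaps R s)"
  by (simp add: gaps_def arrival_gaps_def internal_gaps_def)

lemma gaps_pos:
  assumes "invar R s" "x \<in> gaps R s"
  shows "0 < x"
proof -
  consider "x \<in> arrival_gaps R s" | "x \<in> internal_gaps R s"
    using assms(2) by (auto simp: gaps_def)
  then show ?thesis
  proof cases
    case 1
    then show ?thesis
      by (auto simp: arrival_gaps_def arrived_requests_def)
  next
    case 2
    then show ?thesis
      using waiting_invar(2)[OF assms(1) newest_waiting(1)] speed_pos[of R s]
      by (auto simp: internal_gaps_def alive_def split: if_splits)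
  qed
qed

lemma duration_pos: "invar R s \<Longrightarrow> gaps R s \<noteq> {} \<Longrightarrow> 0 < duration R s"
  unfolding duration_def using gaps_pos[of R s] Min_in[OF finite_gaps, of R s] by auto

lemma duration_nonneg: "invar R s \<Longrightarrow> 0 \<le> duration R s"
  using duration_pos[of R s] by (cases "gaps R s = {}") (auto simp: duration_def)

lemma duration_le: "x \<in> gaps R s \<Longrightarrow> duration R s \<le> x"
  unfolding duration_def by auto

lemma duration_le_arrival:
  assumes "r \<in> requests_of n R" "now s < arrival R r"
  shows "now s + duration R s \<le> arrival R r"
proof -
  have "arrival R r - now s \<in> gaps R s"
    using assms by (auto simp: gaps_def arrival_gaps_def arrived_requests_def)
  then show ?thesis
    using duration_le by fastforce
qed

lemma got_bound:
  assumes "r \<in> alive R s"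
  shows "got s r + frate R s (fst r) * duration R s \<le> \<sigma> (fst r)"
proof (cases "0 < frate R s (fst r)")
  case True
  then have "(\<sigma> (fst r) - got s r) / frate R s (fst r) \<in> gaps R s"
    using assms by (auto simp: gaps_def internal_gaps_def)
  from duration_le[OF this] show ?thesis
    using True by (simp add: field_simps)
next
  case False
  then have "frate R s (fst r) = 0"
    using frate_nonneg[of R s "fst r"] by simp
  then show ?thesis
    using assms by (simp add: alive_def)
qed

lemma progress_bound:
  assumes "invar R s"
  shows "progress s p + prate R s p * duration R s \<le> \<sigma> p"
proof (cases "waiting R s \<noteq> {} \<and> p = fst (newest_waiting R s)")
  case True
  then have "(\<sigma> p - progress s p) / speed R s \<in> gaps R s"
    by (auto simp: gaps_def internal_gaps_def)
  from duration_le[OF this] show ?thesis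
    using True speed_pos[of R s] by (simp add: field_simps prate_def)
next
  case False
  then have "prate R s p = 0"
    by (auto simp: prate_def speed_def)
  then show ?thesis
    using assms by (simp add: invar_def)
qed

lemma invar_initial: "invar R initial"
  using size_pos by (auto simp: invar_def arrived_requests_def requests_of_def)

lemma invar_step:
  assumes inv: "invar R s"
  shows "invar R (step R s)"
proof -
  let ?d = "duration R s"
  have d: "0 \<le> ?d"
    by (rule duration_nonneg[OF inv])
  have fr: "0 \<le> frate R s p * ?d" "0 \<le> prate R s p * ?d" for p
    using d frate_nonneg[of R s p] prate_nonneg[of R s p] by auto
  have mono: "r \<in> arrived_requests n R (now s + ?d)" if "r \<in> arrived_requests n R (now s)" for r
    using that d by (auto simp: arrived_requests_def)
  have I: "0 \<le> now s" "\<And>r. 0 \<le> got s r"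
    "\<And>r. r \<notin> arrived_requests n R (now s) \<Longrightarrow> got s r = 0"
    "\<And>p. 0 \<le> progress s p" "\<And>p. progress s p \<le> \<sigma> p" "\<And>p. 0 \<le> start s p" "\<And>p. start s p \<le> now s"
    "\<And>p. 0 \<le> fwork s p - base s p"
    "\<And>r. r \<in> arrived_requests n R (now s) \<Longrightarrow> start s (fst r) < arrival R r \<Longrightarrow>
        got s r \<le> fwork s (fst r) - base s (fst r)"
    "\<And>r. r \<in> arrived_requests n R (now s) \<Longrightarrow> arrival R r \<le> start s (fst r) \<Longrightarrow>
        progress s (fst r) = \<sigma> (fst r) \<Longrightarrow> r \<in> satisfied s"
    using inv unfolding invar_def by auto
  have "0 \<le> now (step R s)"
    using I(1) d by simp
  moreover have "0 \<le> got (step R s) r" for r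
    using I(2)[of r] fr by simp
  moreover have "got (step R s) r = 0" if "r \<notin> arrived_requests n R (now (step R s))" for r
    using that mono[of r] I(3)[of r] by auto
  moreover have "0 \<le> progress (step R s) p" "progress (step R s) p \<le> \<sigma> p"
    "0 \<le> start (step R s) p" "start (step R s) p \<le> now (step R s)" for p
    using I(1) I(4,6,7)[of p] fr[of p] d progress_bound[OF inv, of p] by auto
  moreover have "0 \<le> fwork (step R s) p - base (step R s) p \<and>
      (fwork (step R s) p - base (step R s) p < progress (step R s) p \<or>
        fwork (step R s) p = base (step R s) p \<and> progress (step R s) p = 0)" for p
    using I(8)[of p] fr[of p] by (auto simp: restart_def)
  moreover have "got (step R s) r \<le> fwork (step R s) (fst r) - base (step R s) (fst r)"
    if "r \<in> arrived_requests n R (now (step R s))" "start (step R s) (fst r) < arrival R r" for r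
  proof (cases "r \<in> arrived_requests n R (now s)")
    case True
    then show ?thesis
      using I(9)[of r] that(2) d by (auto simp: arrived_requests_def split: if_splits)
  next
    case False
    then show ?thesis
      using I(3)[of r] I(8)[of "fst r"] fr[of "fst r"] that by auto
  qed
  moreover have "r \<in> satisfied (step R s)"
    if "r \<in> arrived_requests n R (now (step R s))" "arrival R r \<le> start (step R s) (fst r)"
      "progress (step R s) (fst r) = \<sigma> (fst r)" for r
  proof -
    have "fst r < n"
      using that(1) by (auto simp: arrived_requests_def requests_of_def)
    then have *: "\<not> restart R s (fst r)"
      using that(3) size_pos[of "fst r"] by auto
    then have "arrival R r \<le> start s (fst r)"
      using that(2) by simp
    moreover from this have "r \<in> arrived_requests n R (now s)"
      using that(1) I(7)[of "fst r"] by (auto simp: arrived_requests_def)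
    ultimately show ?thesis
      using that(3) * by (auto simp: served_def)
  qed
  ultimately show ?thesis
    unfolding invar_def by blast
qed

lemma invar_trajectory: "invar R (trajectory R k)"
  by (induction k) (auto intro: invar_initial invar_step)

subsection \<open>Termination and dependence on the past only\<close>

text \<open>An alive request forces a nonempty \<open>late\<close> set, whose pages have positive
  rate, and thus a pending fractional completion.\<close>

lemma gaps_empty:
  assumes "gaps R s = {}"
  shows "alive R s = {}" "waiting R s = {}" "requests_of n R \<subseteq> arrived_requests n R (now s)"
proof -
  show "alive R s = {}"
  proof (rule ccontr)
    assume "alive R s \<noteq> {}"
    then have "0 < card (late R s)"
      using quota_pos[of R s] late(2)[of R s] by simp
    then have "late R s \<noteq> {}"
      by (simp add: card_gt_0_iff)
    then obtain r where r: "r \<in> late R s"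
      by blast
    then have "r \<in> {r \<in> alive R s. 0 < frate R s (fst r)}"
      using frate_pos late(1) by blast
    then have "(\<sigma> (fst r) - got s r) / frate R s (fst r) \<in> gaps R s"
      unfolding gaps_def internal_gaps_def by blast
    then show False
      using assms by blast
  qed
  show "waiting R s = {}"
    using assms by (auto simp: gaps_def internal_gaps_def split: if_splits)
  show "requests_of n R \<subseteq> arrived_requests n R (now s)"
    using assms by (auto simp: gaps_def arrival_gaps_def)
qed

lemma gaps_empty_step:
  assumes "gaps R s = {}"
  shows "gaps R (step R s) = {}"
proof -
  have d: "duration R s = 0"
    using assms by (simp add: duration_def)
  have "alive R (step R s) = {}"
    using gaps_empty(1)[OF assms] d by (simp add: alive_def)
  moreover have "waiting R (step R s) = {}"
    using gaps_empty(2)[OF assms] d by (auto simp: waiting_iff set_eq_iff)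
  moreover have "arrival_gaps R (step R s) = {}"
    using gaps_empty(3)[OF assms] d by (auto simp: arrival_gaps_def)
  ultimately show ?thesis
    by (simp add: gaps_def internal_gaps_def)
qed

lemma gaps_empty_trajectory:
  assumes "gaps R (trajectory R j) = {}" "j \<le> k"
  shows "gaps R (trajectory R k) = {}"
  using assms(2,1) by (induction rule: dec_induct) (simp_all add: gaps_empty_step)

text \<open>Every step completes an arrival, a fractional completion or a transmission, so it lowers this count.\<close>

definition potential :: "requests \<Rightarrow> state \<Rightarrow> nat" where
  "potential R s = card (requests_of n R - arrived_requests n R (now s)) +
     card {r \<in> requests_of n R. got s r < \<sigma> (fst r)} + card {r \<in> requests_of n R. r \<notin> satisfied s}"

lemma potential_step:
  assumes inv: "invar R s" and ne: "gaps R s \<noteq> {}"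
  shows "potential R (step R s) < potential R s"
proof -
  let ?s = "step R s"
  let ?A = "\<lambda>s. requests_of n R - arrived_requests n R (now s)"
  let ?B = "\<lambda>s. {r \<in> requests_of n R. got s r < \<sigma> (fst r)}"
  let ?C = "\<lambda>s. {r \<in> requests_of n R. r \<notin> satisfied s}"
  have d: "0 < duration R s"
    using duration_pos inv ne by blast
  have fin: "finite (?A s)" "finite (?B s)" "finite (?C s)"
    by auto
  have sub: "?A ?s \<subseteq> ?A s" "?B ?s \<subseteq> ?B s" "?C ?s \<subseteq> ?C s"
  proof -
    show "?A ?s \<subseteq> ?A s"
      using d by (auto simp: arrived_requests_def)
    have "got s r \<le> got ?s r" for r
      using d frate_nonneg[of R s "fst r"] by simp
    then show "?B ?s \<subseteq> ?B s"
      using order.strict_trans1 by blast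
    show "?C ?s \<subseteq> ?C s"
      by auto
  qed
  have min: "duration R s \<in> gaps R s"
    using ne by (simp add: duration_def)
  have "?A ?s \<noteq> ?A s \<or> ?B ?s \<noteq> ?B s \<or> ?C ?s \<noteq> ?C s"
  proof -
    consider r where "r \<in> requests_of n R" "r \<notin> arrived_requests n R (now s)"
        "duration R s = arrival R r - now s"
      | r where "r \<in> alive R s" "0 < frate R s (fst r)"
        "duration R s = (\<sigma> (fst r) - got s r) / frate R s (fst r)"
      | "waiting R s \<noteq> {}" "duration R s =
          (\<sigma> (fst (newest_waiting R s)) - progress s (fst (newest_waiting R s))) / speed R s"
      using min unfolding gaps_def arrival_gaps_def internal_gaps_def
      by (auto split: if_splits)
    then show ?thesis
    proof cases
      case (1 r)
      then have "r \<in> ?A s" "r \<notin> ?A ?s"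
        by (auto simp: arrived_requests_def)
      then show ?thesis by blast
    next
      case (2 r)
      then have "got ?s r = \<sigma> (fst r)"
        by (simp add: alive_def)
      then have "r \<in> ?B s" "r \<notin> ?B ?s"
        using 2(1) by (auto simp: alive_def arrived_requests_def)
      then show ?thesis by blast
    next
      case 3
      let ?r = "newest_waiting R s"
      have r: "?r \<in> waiting R s"
        using 3(1) by (rule newest_waiting(1))
      have "progress s (fst ?r) + prate R s (fst ?r) * duration R s = \<sigma> (fst ?r)"
        using 3 speed_pos[of R s] by (simp add: prate_def)
      then have "?r \<in> served R s"
        using r waiting_invar(1)[OF inv r] by (simp add: served_def waiting_iff)
      then have "?r \<in> ?C s" "?r \<notin> ?C ?s"
        using r by (auto simp: waiting_iff arrived_requests_def)
      then show ?thesis by blast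
    qed
  qed
  then have "card (?A ?s) < card (?A s) \<or> card (?B ?s) < card (?B s) \<or> card (?C ?s) < card (?C s)"
    using sub fin psubset_card_mono by (metis (no_types, lifting) psubsetI)
  moreover have "card (?A ?s) \<le> card (?A s)" "card (?B ?s) \<le> card (?B s)" "card (?C ?s) \<le> card (?C s)"
    using sub fin card_mono by blast+
  ultimately show ?thesis
    unfolding potential_def by linarith
qed

lemma ex_gaps_empty: "\<exists>k. gaps R (trajectory R k) = {}"
proof (rule ccontr)
  assume "\<not> ?thesis"
  then have "potential R (trajectory R (Suc k)) < potential R (trajectory R k)" for k
    using potential_step invar_trajectory by simp
  then have "potential R (trajectory R k) + k \<le> potential R (trajectory R 0)" for k
  proof (induction k)
    case (Suc k)
    have "potential R (trajectory R k) + k \<le> potential R (trajectory R 0)"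
      by (rule Suc.IH[OF Suc.prems])
    then show ?case
      using Suc.prems[of k] by linarith
  qed simp
  from this[of "Suc (potential R (trajectory R 0))"] show False
    by simp
qed

definition agree :: "requests \<Rightarrow> requests \<Rightarrow> real \<Rightarrow> bool" where
  "agree R R' t \<longleftrightarrow> (\<forall>u\<le>t. arrived_requests n R u = arrived_requests n R' u) \<and>
     (\<forall>r\<in>arrived_requests n R t. arrival R r = arrival R' r)"

lemma agree_sym: "agree R R' t \<Longrightarrow> agree R' R t"
  by (auto simp: agree_def)

lemma agree_state:
  assumes ag: "agree R R' t" and le: "now s \<le> t"
  shows "alive R s = alive R' s" "pending R s = pending R' s" "waiting R s = waiting R' s"
    "quota R s = quota R' s" "late R s = late R' s" "share R s = share R' s"
    "frate R s = frate R' s" "newest_waiting R s = newest_waiting R' s" "speed R s = speed R' s"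
    "prate R s = prate R' s" "internal_gaps R s = internal_gaps R' s"
proof -
  have arr: "arrived_requests n R (now s) = arrived_requests n R' (now s)"
    using ag le by (auto simp: agree_def)
  have a: "arrival R r = arrival R' r" if "r \<in> arrived_requests n R (now s)" for r
  proof -
    have "r \<in> arrived_requests n R t"
      using that le by (auto simp: arrived_requests_def)
    then show ?thesis
      using ag by (auto simp: agree_def)
  qed
  show al: "alive R s = alive R' s" and pe: "pending R s = pending R' s"
    using arr by (auto simp: alive_def pending_def)
  then show wa: "waiting R s = waiting R' s"
    by (simp add: waiting_def)
  show qu: "quota R s = quota R' s"
    by (simp add: quota_def al)
  have "(L \<subseteq> alive R s \<and> card L = quota R s \<and>
      (\<forall>x\<in>L. \<forall>y\<in>alive R s - L. arrival R y \<le> arrival R x)) \<longleftrightarrow>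
      (L \<subseteq> alive R' s \<and> card L = quota R' s \<and>
      (\<forall>x\<in>L. \<forall>y\<in>alive R' s - L. arrival R' y \<le> arrival R' x))" for L
  proof -
    have "arrival R r = arrival R' r" if "r \<in> alive R' s" for r
      using a that al by (metis (no_types, lifting) alive_def mem_Collect_eq)
    then show ?thesis
      unfolding al qu by (metis DiffD1 subsetD)
  qed
  then show la: "late R s = late R' s"
    unfolding late_def by presburger
  show sh: "share R s = share R' s"
    by (simp add: share_def al qu)
  show fr: "frate R s = frate R' s"
    by (simp add: frate_def sh la fun_eq_iff)
  have "(r \<in> waiting R s \<and> (\<forall>r'\<in>waiting R s. arrival R r' \<le> arrival R r)) \<longleftrightarrow>
      (r \<in> waiting R' s \<and> (\<forall>r'\<in>waiting R' s. arrival R' r' \<le> arrival R' r))" for r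
  proof -
    have "arrival R r = arrival R' r" if "r \<in> waiting R' s" for r
      using a that wa waiting_iff by metis
    then show ?thesis
      unfolding wa by metis
  qed
  then show ne: "newest_waiting R s = newest_waiting R' s"
    unfolding newest_waiting_def by presburger
  show sp: "speed R s = speed R' s"
    by (simp add: speed_def wa pe)
  show pr: "prate R s = prate R' s"
    by (simp add: prate_def sp ne fun_eq_iff)
  show "internal_gaps R s = internal_gaps R' s"
    by (simp add: internal_gaps_def al fr wa ne sp)
qed

lemma agree_gaps:
  assumes ag: "agree R R' t" and le: "now s \<le> t" and x: "x \<in> gaps R s" "x \<le> t - now s"
  shows "x \<in> gaps R' s"
proof (cases "x \<in> internal_gaps R s")
  case True
  then show ?thesis
    using agree_state(11)[OF ag le] by (simp add: gaps_def)
next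
  case False
  then obtain r where r: "r \<in> requests_of n R" "r \<notin> arrived_requests n R (now s)"
      "x = arrival R r - now s"
    using x(1) by (auto simp: gaps_def arrival_gaps_def)
  then have "r \<in> arrived_requests n R t"
    using x(2) by (simp add: arrived_requests_def)
  then have "r \<in> arrived_requests n R' t" "arrival R r = arrival R' r"
    using ag by (auto simp: agree_def)
  moreover have "r \<notin> arrived_requests n R' (now s)"
    using ag le r(2) by (auto simp: agree_def)
  ultimately show ?thesis
    using r(3) by (auto simp: gaps_def arrival_gaps_def arrived_requests_def)
qed

text \<open>A gap that ends after \<open>t\<close> may come from an arrival unknown to the other
  sequence. For a step that ends by \<open>t\<close>, both minima are gaps of either sequence, so
  they coincide.\<close>

lemma agree_duration:
  assumes ag: "agree R R' t" and le: "now s \<le> t"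
    and ne: "gaps R s \<noteq> {}" and d: "duration R s \<le> t - now s"
  shows "duration R' s = duration R s"
proof -
  have "duration R s \<in> gaps R s"
    using ne by (simp add: duration_def)
  then have mem: "duration R s \<in> gaps R' s"
    using agree_gaps[OF ag le] d by blast
  then have 1: "duration R' s \<le> duration R s"
    by (rule duration_le)
  have "duration R' s \<in> gaps R' s"
    using mem by (auto simp: duration_def)
  then have "duration R' s \<in> gaps R s"
    using agree_gaps[OF agree_sym[OF ag] le] 1 d by simp
  then show ?thesis
    using 1 duration_le by fastforce
qed

lemma agree_step:
  assumes ag: "agree R R' t" and le: "now s \<le> t"
    and ne: "gaps R s \<noteq> {}" and d: "duration R s \<le> t - now s"
  shows "step R' s = step R s"
proof -
  have arr: "arrived_requests n R (now s) = arrived_requests n R' (now s)"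
    using ag le by (auto simp: agree_def)
  have a: "arrival R r = arrival R' r" if "r \<in> arrived_requests n R (now s)" for r
  proof -
    have "r \<in> arrived_requests n R t"
      using that le by (auto simp: arrived_requests_def)
    then show ?thesis
      using ag by (auto simp: agree_def)
  qed
  note eqs = agree_state(7,10)[OF ag le] agree_duration[OF ag le ne d]
  have "restart R s = restart R' s"
    by (simp add: restart_def eqs fun_eq_iff)
  moreover have "served R s = served R' s"
    using arr a by (auto simp: served_def eqs)
  ultimately show ?thesis
    unfolding step_def eqs arr by simp
qed

lemma now_mono: "j \<le> k \<Longrightarrow> now (trajectory R j) \<le> now (trajectory R k)"
  by (induction rule: dec_induct) (use duration_nonneg[OF invar_trajectory] in \<open>auto intro: order_trans\<close>)

text \<open>The restriction to indices before the halt matters: once \<open>R\<close> has no event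
  left its trajectory keeps its time, while \<open>R'\<close> may still contain an arrival after
  \<open>t\<close>.\<close>

lemma agree_trajectory:
  assumes ag: "agree R R' t" and "now (trajectory R k) \<le> t"
    and "\<And>j. j < k \<Longrightarrow> gaps R (trajectory R j) \<noteq> {}"
  shows "trajectory R' k = trajectory R k"
  using assms(2,3)
proof (induction k)
  case (Suc k)
  have le: "now (trajectory R k) \<le> t"
    using Suc.prems(1) now_mono[of k "Suc k" R] by linarith
  have "trajectory R' k = trajectory R k"
    using Suc.IH[OF le] Suc.prems(2) by simp
  moreover have "duration R (trajectory R k) \<le> t - now (trajectory R k)"
    using Suc.prems(1) by simp
  ultimately show ?case
    using agree_step[OF ag le] Suc.prems(2)[of k] by simp
qed simp

section \<open>The real schedule read off the trajectory\<close>

definition busy :: "requests \<Rightarrow> real \<Rightarrow> nat \<Rightarrow> bool" where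
  "busy R t k \<longleftrightarrow> now (trajectory R k) \<le> t \<and> t < now (trajectory R (Suc k)) \<and>
     waiting R (trajectory R k) \<noteq> {}"

text \<open>A pass over a page sends its pieces in order, so the current piece is the integer part
  of the amount already sent. All pieces of one pass carry the same transmission number
  \<open>index\<close>. The index chosen by \<open>LEAST\<close> is in fact unique.\<close>

definition sched :: "requests \<Rightarrow> schedule" where
  "sched R t =
     (if \<exists>k. busy R t k
      then let s = trajectory R (LEAST k. busy R t k); p = fst (newest_waiting R s)
           in (speed R s, p, nat \<lfloor>progress s p + speed R s * (t - now s)\<rfloor>, index s p)
      else (0, 0, 0, 0))"

lemma agree_busy:
  assumes ag: "agree R R' t" and b: "busy R t k"
  shows "busy R' t k" "trajectory R' k = trajectory R k"
proof -
  let ?s = "trajectory R k"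
  have le: "now ?s \<le> t" "t < now ?s + duration R ?s" "waiting R ?s \<noteq> {}"
    using b by (auto simp: busy_def)
  have ne: "gaps R (trajectory R j) \<noteq> {}" if "j \<le> k" for j
    using gaps_empty(2) gaps_empty_trajectory[OF _ that] le(3) by blast
  show eq: "trajectory R' k = ?s"
    using agree_trajectory[OF ag le(1)] ne by simp
  have w: "waiting R' ?s \<noteq> {}"
    using agree_state(3)[OF ag le(1)] le(3) by simp
  then have "gaps R' ?s \<noteq> {}"
    using gaps_empty(2) by blast
  \<comment> \<open>Under \<open>R'\<close> the step may end at another time, but not by time
    \<open>t\<close>, since then both durations would be equal.\<close>
  then have "t < now ?s + duration R' ?s"
    using agree_duration[OF agree_sym[OF ag] le(1)] le(2) by (cases "duration R' ?s \<le> t - now ?s") auto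
  then show "busy R' t k"
    using le(1) w eq by (simp add: busy_def)
qed

lemma sched_agree:
  assumes ag: "agree R R' t"
  shows "sched R t = sched R' t"
proof -
  have b: "busy R t = busy R' t"
    using agree_busy(1)[OF ag] agree_busy(1)[OF agree_sym[OF ag]] by blast
  show ?thesis
  proof (cases "\<exists>k. busy R t k")
    case True
    then have k: "busy R t (LEAST k. busy R t k)"
      by (rule LeastI_ex)
    have "now (trajectory R (LEAST k. busy R t k)) \<le> t"
      using k by (simp add: busy_def)
    note st = agree_state(8,9)[OF ag this]
    have "trajectory R' (LEAST k. busy R t k) = trajectory R (LEAST k. busy R t k)"
      using agree_busy(2)[OF ag k] .
    then show ?thesis
      using True by (simp add: sched_def Let_def st flip: b)
  next
    case False
    then show ?thesis
      using b by (simp add: sched_def)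
  qed
qed

lemma agreeI:
  assumes "request_sequence n R" "request_sequence n R'"
    and "\<forall>p<n. arrived R t p = arrived R' t p"
  shows "agree R R' t"
  unfolding agree_def using arrived_requests_cong[OF assms] by blast

lemma sched_busy:
  assumes "busy R t k"
  shows "sched R t = (speed R (trajectory R k), fst (newest_waiting R (trajectory R k)),
     nat \<lfloor>progress (trajectory R k) (fst (newest_waiting R (trajectory R k))) +
       speed R (trajectory R k) * (t - now (trajectory R k))\<rfloor>,
     index (trajectory R k) (fst (newest_waiting R (trajectory R k))))"
proof -
  have "j = k" if "busy R t j" for j
    using assms that now_mono[of "Suc j" k R] now_mono[of "Suc k" j R]
    by (cases j k rule: linorder_cases) (auto simp: busy_def)
  then have "(LEAST k. busy R t k) = k"
    using assms by (metis LeastI)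
  then show ?thesis
    using assms by (auto simp: sched_def Let_def)
qed

end

section \<open>Real work against fractional work\<close>

locale broadcast_run = broadcast +
  fixes R :: requests
  assumes R: "request_sequence n R"
begin

abbreviation S :: "nat \<Rightarrow> state" where "S k \<equiv> trajectory R k"
abbreviation T :: "nat \<Rightarrow> real" where "T k \<equiv> now (S k)"
abbreviation dur :: "nat \<Rightarrow> real" where "dur k \<equiv> duration R (S k)"
abbreviation W :: "nat \<Rightarrow> nat \<Rightarrow> real" where "W k p \<equiv> fwork (S k) p"

definition last_step :: nat where
  "last_step = (LEAST k. gaps R (S k) = {})"

definition arr_step :: "request \<Rightarrow> nat" where
  "arr_step r = (LEAST k. arrival R r \<le> T k)"

definition weight :: "nat \<Rightarrow> real" where
  "weight k = k / Q k"

lemma gaps_last_step: "gaps R (S last_step) = {}"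
  unfolding last_step_def using ex_gaps_empty by (rule LeastI_ex)

lemma dur_nonneg: "0 \<le> dur k"
  by (rule duration_nonneg[OF invar_trajectory])

lemma arrival_nonneg: "r \<in> requests_of n R \<Longrightarrow> 0 \<le> arrival R r"
  using R unfolding request_sequence_def requests_of_def arrival_def by auto

lemma arrival_le_last: "r \<in> requests_of n R \<Longrightarrow> arrival R r \<le> T last_step"
  using gaps_empty(3)[OF gaps_last_step] by (auto simp: arrived_requests_def)

lemma arrival_le_iff:
  assumes "r \<in> requests_of n R"
  shows "arrival R r \<le> T k \<longleftrightarrow> arr_step r \<le> k"
proof
  show "arrival R r \<le> T k \<Longrightarrow> arr_step r \<le> k"
    unfolding arr_step_def by (rule Least_le)
next
  assume "arr_step r \<le> k"
  moreover have "arrival R r \<le> T (arr_step r)"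
    unfolding arr_step_def using arrival_le_last[OF assms] by (rule LeastI)
  ultimately show "arrival R r \<le> T k"
    using now_mono[of "arr_step r" k R] by linarith
qed

text \<open>A step never jumps over an arrival, so arrivals happen exactly at step boundaries; the
  nonnegativity of arrival times settles index 0.\<close>

lemma T_arr_step:
  assumes "r \<in> requests_of n R"
  shows "T (arr_step r) = arrival R r"
proof (cases "arr_step r")
  case 0
  have "arrival R r \<le> T (arr_step r)"
    using arrival_le_iff[OF assms] by simp
  then show ?thesis
    using arrival_nonneg[OF assms] 0 by simp
next
  case (Suc i)
  then have "T i < arrival R r"
    using arrival_le_iff[OF assms, of i] by simp
  then have "T (Suc i) \<le> arrival R r"
    using duration_le_arrival[OF assms] by simp
  moreover have "arrival R r \<le> T (Suc i)"
    using arrival_le_iff[OF assms, of "Suc i"] Suc by simp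
  ultimately show ?thesis
    using Suc by simp
qed

lemma arrived_iff:
  "r \<in> arrived_requests n R (T k) \<longleftrightarrow> r \<in> requests_of n R \<and> arr_step r \<le> k"
  using arrival_le_iff[of r k] unfolding arrived_requests_def by blast

lemma W_mono: "j \<le> k \<Longrightarrow> W j p \<le> W k p"
  by (induction rule: dec_induct)
    (use dur_nonneg frate_nonneg in \<open>auto intro: order_trans mult_nonneg_nonneg\<close>)

lemma got_before:
  assumes "k \<le> arr_step r"
  shows "got (S k) r = 0"
  using assms by (induction k) (auto simp: arrived_iff)

lemma got_eq:
  assumes "r \<in> requests_of n R" "arr_step r \<le> k"
  shows "got (S k) r = W k (fst r) - W (arr_step r) (fst r)"
  using assms(2)
proof (induction rule: dec_induct)
  case base
  then show ?case by (simp add: got_before)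
next
  case (step k)
  then show ?case using assms(1) by (simp add: arrived_iff)
qed

lemma got_mono: "j \<le> k \<Longrightarrow> got (S j) r \<le> got (S k) r"
  by (induction rule: dec_induct)
    (use dur_nonneg frate_nonneg in \<open>auto intro: order_trans mult_nonneg_nonneg\<close>)

lemma satisfied_mono: "j \<le> k \<Longrightarrow> satisfied (S j) \<subseteq> satisfied (S k)"
  by (induction rule: dec_induct) auto

lemma alive_antimono:
  assumes "r \<in> alive R (S k)" "arr_step r \<le> j" "j \<le> k"
  shows "r \<in> alive R (S j)"
  using assms got_mono[OF assms(3), of r] by (auto simp: alive_def arrived_iff)

lemma pending_antimono:
  assumes "r \<in> pending R (S k)" "arr_step r \<le> j" "j \<le> k"
  shows "r \<in> pending R (S j)"
  using assms got_mono[OF assms(3), of r] satisfied_mono[OF assms(3)]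
  by (auto simp: pending_def arrived_iff)

lemma arr_step_mono:
  assumes "r \<in> requests_of n R" "r' \<in> requests_of n R" "arrival R r \<le> arrival R r'"
  shows "arr_step r \<le> arr_step r'"
  using assms arrival_le_iff[of r "arr_step r'"] T_arr_step[of r'] by simp

lemma weight_nonneg: "0 \<le> weight k"
  unfolding weight_def by (simp add: Q_nonneg)

lemma weight_mono: "j \<le> k \<Longrightarrow> weight j \<le> weight k"
  using weight_nonneg[of k] Q_ratio_mono[of j k] by (cases "j = 0") (auto simp: weight_def)

text \<open>
  Fractional work on page \<open>p\<close> at positions above \<open>low_mark k p\<close> has not yet been used to pay for real
  work. Real work on \<open>p\<close> raises the mark and is charged to the fractional work that it passes.
\<close>

definition low_mark :: "nat \<Rightarrow> nat \<Rightarrow> real" where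
  "low_mark k p = base (S k) p - \<sigma> p + progress (S k) p"

lemma low_mark_step: "low_mark k p + prate R (S k) p * dur k \<le> low_mark (Suc k) p"
  by (auto simp: low_mark_def restart_def)

lemma low_mark_mono: "low_mark k p \<le> low_mark (Suc k) p"
  using low_mark_step[of k p] dur_nonneg[of k] prate_nonneg[of R "S k" p]
  by (smt (verit) mult_nonneg_nonneg)

lemma low_mark_le: "low_mark k p \<le> W k p"
  using invar_trajectory[of R k] unfolding invar_def low_mark_def by (smt (verit))

text \<open>Since its arrival the newest waiting request has seen at least a full page of fractional
  work, of which at most \<open>progress\<close> was done after the start of the transmission; so
  the mark is not below the position at its arrival. All other waiting requests are at least as old,
  so each of them has been pending ever since.\<close>

lemma newest_low_mark:
  assumes "waiting R (S k) \<noteq> {}"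
  defines "r \<equiv> newest_waiting R (S k)"
  shows "r \<in> requests_of n R" "arr_step r \<le> k" "W (arr_step r) (fst r) \<le> low_mark k (fst r)"
    and "arr_step r \<le> j \<Longrightarrow> j \<le> k \<Longrightarrow>
      weight (card (waiting R (S k))) \<le> weight (card (pending R (S j)))"
proof -
  have r: "r \<in> waiting R (S k)"
    unfolding r_def by (rule newest_waiting(1)[OF assms(1)])
  then show req: "r \<in> requests_of n R" and a: "arr_step r \<le> k"
    by (auto simp: waiting_iff arrived_iff)
  have "\<sigma> (fst r) \<le> W k (fst r) - W (arr_step r) (fst r)"
    using r got_eq[OF req a] by (simp add: waiting_iff)
  moreover have "W k (fst r) - base (S k) (fst r) \<le> progress (S k) (fst r)"
    using invar_trajectory[of R k] unfolding invar_def by (smt (verit))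
  ultimately show "W (arr_step r) (fst r) \<le> low_mark k (fst r)"
    by (simp add: low_mark_def)
  assume j: "arr_step r \<le> j" "j \<le> k"
  have "waiting R (S k) \<subseteq> pending R (S j)"
  proof
    fix x assume x: "x \<in> waiting R (S k)"
    then have "x \<in> requests_of n R"
      by (auto simp: waiting_iff arrived_iff)
    then have "arr_step x \<le> arr_step r"
      using arr_step_mono req newest_waiting(2)[OF assms(1) x] unfolding r_def by blast
    then show "x \<in> pending R (S j)"
      using pending_antimono[of x k j] x j alive_subset(3) by fastforce
  qed
  then show "weight (card (waiting R (S k))) \<le> weight (card (pending R (S j)))"
    by (intro weight_mono card_mono) auto
qed

text \<open>A discrete integral over the positions of fractional work on \<open>p\<close> up to
  \<open>x\<close>: each position reached in the first \<open>k\<close> steps is weighted by the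
  pending count of the step that reached it.\<close>

definition charge :: "nat \<Rightarrow> nat \<Rightarrow> real \<Rightarrow> real" where
  "charge p k x =
     (\<Sum>j<k. weight (card (pending R (S j))) * (min x (W (Suc j) p) - min x (W j p)))"

text \<open>The positions between the mark and \<open>L\<close> were all reached between the arrival
  of the newest waiting request and the end of step \<open>k\<close>, when the weight was at least
  that of the requests waiting now.\<close>

lemma charge_diff:
  assumes "waiting R (S k) \<noteq> {}" "p = fst (newest_waiting R (S k))"
    and L: "low_mark k p \<le> L" "L \<le> W (Suc k) p"
  shows "weight (card (waiting R (S k))) * (L - low_mark k p) \<le> charge p (Suc k) L - charge p (Suc k) (low_mark k p)"
proof -
  let ?r = "newest_waiting R (S k)"
  let ?a = "arr_step ?r"
  let ?f = "\<lambda>x j. min x (W j p)"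
  let ?D = "\<lambda>j. (?f L (Suc j) - ?f L j) - (?f (low_mark k p) (Suc j) - ?f (low_mark k p) j)"
  note nl = newest_low_mark[OF assms(1), folded assms(2)]
  have D: "0 \<le> ?D j" for j
    using W_mono[of j "Suc j" p] L(1) by (auto simp: min_def)
  have "(\<Sum>j=?a..k. ?f x (Suc j) - ?f x j) = ?f x (Suc k) - ?f x ?a" for x
    using nl(2) by (intro sum_Suc_diff) simp
  then have "(\<Sum>j=?a..k. ?D j) = (?f L (Suc k) - ?f L ?a) - (?f (low_mark k p) (Suc k) - ?f (low_mark k p) ?a)"
    by (simp only: sum_subtractf)
  also have "\<dots> = L - low_mark k p"
    using nl(3) L W_mono[of k "Suc k" p] low_mark_le[of k p] by (auto simp: min_def)
  finally have "weight (card (waiting R (S k))) * (L - low_mark k p) =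
      (\<Sum>j=?a..k. weight (card (waiting R (S k))) * ?D j)"
    by (simp only: sum_distrib_left[symmetric])
  also have "\<dots> \<le> (\<Sum>j=?a..k. weight (card (pending R (S j))) * ?D j)"
    by (intro sum_mono mult_right_mono nl(4) D) auto
  also have "\<dots> \<le> (\<Sum>j<Suc k. weight (card (pending R (S j))) * ?D j)"
    by (intro sum_mono2 mult_nonneg_nonneg weight_nonneg D) auto
  also have "\<dots> = charge p (Suc k) L - charge p (Suc k) (low_mark k p)"
    by (simp only: charge_def right_diff_distrib sum_subtractf)
  finally show ?thesis .
qed

lemma charge_mono:
  assumes "x \<le> y"
  shows "charge p k x \<le> charge p (Suc k) y"
proof -
  have "charge p k x \<le> charge p k y"
    unfolding charge_def
  proof (intro sum_mono mult_left_mono weight_nonneg)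
    show "min x (W (Suc j) p) - min x (W j p) \<le> min y (W (Suc j) p) - min y (W j p)" for j
      using assms W_mono[of j "Suc j" p] by (auto simp: min_def)
  qed
  also have "\<dots> \<le> charge p (Suc k) y"
    using W_mono[of k "Suc k" p] weight_nonneg
    by (auto simp: charge_def min_def intro!: mult_nonneg_nonneg)
  finally show ?thesis .
qed

text \<open>This is the injectivity of the charging: all real work so far is paid by fractional work
  below the current mark, and the mark never goes down, so no position pays twice. A restart may
  raise it further, which only forfeits positions.\<close>

lemma broadcast_work_charge:
  "(\<Sum>j<k. prate R (S j) p * dur j * weight (card (waiting R (S j)))) \<le> charge p k (low_mark k p)"
proof (induction k)
  case 0
  then show ?case by (simp add: charge_def)
next
  case (Suc k)
  have "prate R (S k) p * dur k * weight (card (waiting R (S k))) + charge p k (low_mark k p)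
      \<le> charge p (Suc k) (low_mark (Suc k) p)"
  proof (cases "waiting R (S k) \<noteq> {} \<and> p = fst (newest_waiting R (S k))")
    case True
    then have "weight (card (waiting R (S k))) * (low_mark (Suc k) p - low_mark k p)
        \<le> charge p (Suc k) (low_mark (Suc k) p) - charge p (Suc k) (low_mark k p)"
      by (intro charge_diff low_mark_mono low_mark_le) auto
    moreover have "weight (card (waiting R (S k))) * (prate R (S k) p * dur k)
        \<le> weight (card (waiting R (S k))) * (low_mark (Suc k) p - low_mark k p)"
      using low_mark_step[of k p] by (intro mult_left_mono weight_nonneg) simp
    ultimately show ?thesis
      using charge_mono[of "low_mark k p" "low_mark k p" p k] by (simp add: mult.commute)
  next
    case False
    then have "prate R (S k) p = 0"
      by (auto simp: prate_def speed_def)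
    then show ?thesis
      using charge_mono[OF low_mark_mono] by simp
  qed
  then show ?case
    using Suc.IH by simp
qed

lemma page_work_charge:
  "(\<Sum>j<k. prate R (S j) p * dur j * weight (card (waiting R (S j))))
     \<le> (\<Sum>j<k. frate R (S j) p * dur j * weight (card (pending R (S j))))"
proof -
  have "charge p k x \<le> (\<Sum>j<k. frate R (S j) p * dur j * weight (card (pending R (S j))))" for x
    unfolding charge_def
  proof (intro sum_mono)
    fix j
    have "min x (W (Suc j) p) - min x (W j p) \<le> frate R (S j) p * dur j"
      using W_mono[of j "Suc j" p] by (auto simp: min_def)
    then show "weight (card (pending R (S j))) * (min x (W (Suc j) p) - min x (W j p))
        \<le> frate R (S j) p * dur j * weight (card (pending R (S j)))"
      using weight_nonneg mult_left_mono by (metis mult.commute)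
  qed
  then show ?thesis
    using broadcast_work_charge order_trans by blast
qed

lemma sum_prate: "(\<Sum>p<n. prate R (S k) p) = speed R (S k)"
proof (cases "waiting R (S k) = {}")
  case False
  then have "fst (newest_waiting R (S k)) < n"
    using newest_low_mark(1) by (auto simp: requests_of_def)
  then show ?thesis
    by (simp add: prate_def)
qed (simp add: prate_def speed_def)

lemma speed_weight_ge:
  "(1 + \<epsilon>) * card (waiting R (S k)) \<le> speed R (S k) * weight (card (waiting R (S k)))"
proof (cases "waiting R (S k) = {}")
  case False
  let ?w = "card (waiting R (S k))" and ?u = "card (pending R (S k))"
  have w: "0 < ?w" "?w \<le> ?u"
    using False by (auto simp: card_gt_0_iff card_pending)
  then have "?w * Q ?w \<le> ?w * Q ?u"
    by (intro mult_left_mono Q_mono) auto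
  then have "?w \<le> Q ?u * weight ?w"
    using Q_pos[of ?w] w by (simp add: weight_def field_simps)
  then have "(1 + \<epsilon>) * ?w \<le> (1 + \<epsilon>) * (Q ?u * weight ?w)"
    using eps by (intro mult_left_mono) auto
  then show ?thesis
    using False by (simp add: speed_def mult.assoc)
qed (simp add: weight_def)

lemma frate_weight_le:
  "(\<Sum>p<n. frate R (S k) p) * weight (card (pending R (S k))) \<le> (1 + \<epsilon> / 3) * card (pending R (S k))"
proof (cases "alive R (S k) = {}")
  case True
  then show ?thesis
    using eps by (simp add: sum_frate)
next
  case False
  let ?u = "card (pending R (S k))" and ?a = "card (alive R (S k))"
  have u: "0 < ?a" "?a \<le> ?u"
    using False by (auto simp: card_gt_0_iff card_pending)
  then have "Q ?a * ?u \<le> Q ?u * ?u"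
    by (intro mult_right_mono Q_mono) auto
  then have "Q ?a * weight ?u \<le> ?u"
    using Q_pos[of ?u] u by (simp add: weight_def field_simps)
  then have "(1 + \<epsilon> / 3) * (Q ?a * weight ?u) \<le> (1 + \<epsilon> / 3) * ?u"
    using eps by (intro mult_left_mono) auto
  then show ?thesis
    using False by (simp add: sum_frate mult.assoc)
qed

lemma sum_pending_le:
  "(\<Sum>j<k. dur j * card (pending R (S j))) \<le> 3 / \<epsilon> * (\<Sum>j<k. dur j * card (alive R (S j)))"
proof -
  let ?P = "\<Sum>j<k. dur j * card (pending R (S j))"
  let ?A = "\<Sum>j<k. dur j * card (alive R (S j))"
  let ?V = "\<Sum>j<k. dur j * card (waiting R (S j))"
  have "(1 + \<epsilon>) * ?V = (\<Sum>j<k. dur j * ((1 + \<epsilon>) * card (waiting R (S j))))"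
    by (simp add: sum_distrib_left mult.left_commute)
  also have "\<dots> \<le> (\<Sum>j<k. dur j * (speed R (S j) * weight (card (waiting R (S j)))))"
    by (intro sum_mono mult_left_mono speed_weight_ge dur_nonneg)
  also have "\<dots> = (\<Sum>j<k. \<Sum>p<n. prate R (S j) p * dur j * weight (card (waiting R (S j))))"
    by (simp add: sum_prate[symmetric] sum_distrib_left sum_distrib_right mult_ac)
  also have "\<dots> = (\<Sum>p<n. \<Sum>j<k. prate R (S j) p * dur j * weight (card (waiting R (S j))))"
    by (rule sum.swap)
  also have "\<dots> \<le> (\<Sum>p<n. \<Sum>j<k. frate R (S j) p * dur j * weight (card (pending R (S j))))"
    by (intro sum_mono page_work_charge)
  also have "\<dots> = (\<Sum>j<k. \<Sum>p<n. frate R (S j) p * dur j * weight (card (pending R (S j))))"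
    by (rule sum.swap)
  also have "\<dots> = (\<Sum>j<k. dur j * ((\<Sum>p<n. frate R (S j) p) * weight (card (pending R (S j)))))"
    by (simp add: sum_distrib_left sum_distrib_right mult_ac)
  also have "\<dots> \<le> (\<Sum>j<k. dur j * ((1 + \<epsilon> / 3) * card (pending R (S j))))"
    by (intro sum_mono mult_left_mono frate_weight_le dur_nonneg)
  also have "\<dots> = (1 + \<epsilon> / 3) * ?P"
    by (simp add: sum_distrib_left mult.left_commute)
  finally have 1: "(1 + \<epsilon>) * ?V \<le> (1 + \<epsilon> / 3) * ?P" .
  have "?P = ?A + ?V"
    by (simp add: card_pending sum.distrib distrib_left)
  \<comment> \<open>Substituting \<open>?V = ?P - ?A\<close> leaves the difference of 1 + \<epsilon>
    and 1 + \<epsilon> / 3 as the coefficient of \<open>?P\<close>; bounding 1 + \<epsilon> by 2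
    then gives the factor 3 / \<epsilon>.\<close>
  then have "2 * \<epsilon> / 3 * ?P \<le> (1 + \<epsilon>) * ?A"
    using 1 by (simp add: algebra_simps)
  also have "\<dots> \<le> 2 * ?A"
    using eps dur_nonneg by (intro mult_right_mono sum_nonneg) auto
  finally show ?thesis
    using eps by (simp add: field_simps)
qed

section \<open>Late requests: weights in the past and shares in the future\<close>

lemma late_card_le:
  assumes "r \<in> late R (S k)" "arr_step r \<le> j" "j \<le> k"
  shows "(1 - \<epsilon> / 12) * card (alive R (S k)) \<le> card (alive R (S j))"
proof -
  have r: "r \<in> alive R (S k)"
    using assms(1) late(1) by blast
  \<comment> \<open>Alive requests outside \<open>late\<close> arrived no later than
    \<open>r\<close> and were therefore alive whenever \<open>r\<close> was. Counting
    \<open>r\<close> itself adds 1, which cancels the rounding up in \<open>quota\<close>.\<close>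
  have "insert r (alive R (S k) - late R (S k)) \<subseteq> alive R (S j)"
  proof
    fix x assume x: "x \<in> insert r (alive R (S k) - late R (S k))"
    then have xa: "x \<in> alive R (S k)" "arrival R x \<le> arrival R r"
      using r late(3)[OF assms(1), of x] by blast+
    then have "arr_step x \<le> arr_step r"
      using r by (intro arr_step_mono) (auto simp: alive_def arrived_iff)
    then show "x \<in> alive R (S j)"
      using alive_antimono[of x k j] xa(1) assms(2,3) by simp
  qed
  then have "card (insert r (alive R (S k) - late R (S k))) \<le> card (alive R (S j))"
    by (intro card_mono) auto
  moreover have "card (insert r (alive R (S k) - late R (S k))) =
      Suc (card (alive R (S k)) - quota R (S k))"
    using assms(1) late(1,2)[of R "S k"] by (simp add: card_Diff_subset)
  ultimately have "card (alive R (S k)) + 1 \<le> card (alive R (S j)) + quota R (S k)"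
    by linarith
  then have "real (card (alive R (S k))) + 1 \<le> card (alive R (S j)) + quota R (S k)"
    by linarith
  then show ?thesis
    using quota_le[of R "S k"] by (simp add: algebra_simps)
qed

text \<open>If there were at least as many alive requests at step \<open>j\<close>, the weight is
  monotone. Otherwise only the numerator loses the factor \<open>1 - \<epsilon> / 12\<close>,
  because the denominator \<open>Q\<close> is smaller for the smaller count.\<close>

lemma late_weight_le:
  assumes "r \<in> late R (S k)" "arr_step r \<le> j" "j \<le> k"
  shows "(1 - \<epsilon> / 12) * weight (card (alive R (S k))) \<le> weight (card (alive R (S j)))"
proof (cases "card (alive R (S k)) \<le> card (alive R (S j))")
  case True
  have "(1 - \<epsilon> / 12) * weight (card (alive R (S k))) \<le> 1 * weight (card (alive R (S k)))"
    using eps by (intro mult_right_mono weight_nonneg) auto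
  then show ?thesis
    using weight_mono[OF True] by simp
next
  case False
  let ?a = "card (alive R (S k))" and ?b = "card (alive R (S j))"
  have r: "r \<in> alive R (S k)"
    using assms(1) late(1) by blast
  have "r \<in> alive R (S j)"
    by (rule alive_antimono[OF r assms(2,3)])
  then have b: "0 < ?b"
    using card_gt_0_iff finite_alive(1) by blast
  have "(1 - \<epsilon> / 12) * weight ?a \<le> ?b / Q ?a"
    using late_card_le[OF assms] Q_nonneg[of ?a] by (simp add: weight_def divide_right_mono)
  also have "\<dots> \<le> weight ?b"
    using False b Q_pos[of ?b] Q_mono[of ?b ?a] by (simp add: weight_def divide_left_mono)
  finally show ?thesis .
qed

text \<open>The length of the part of step \<open>k\<close> that lies after time
  \<open>u\<close>.\<close>

definition len :: "nat \<Rightarrow> real \<Rightarrow> real" where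
  "len k u = max 0 (T (Suc k) - max u (T k))"

text \<open>Let \<open>h\<close> be the last step giving a share to a late request for
  \<open>p\<close> older than \<open>u\<close>, and \<open>x\<close> such a request there. Every
  counted share is part of the page's rate after \<open>u\<close>, hence after the arrival of
  \<open>x\<close>. So all of it was also received by \<open>x\<close>, which is alive in step
  \<open>h\<close> and gets no more than the size of the page.\<close>

lemma future_share_le:
  assumes "p < n"
  shows "(\<Sum>k<m. \<Sum>r\<in>{r \<in> late R (S k). fst r = p \<and> arrival R r < u}. share R (S k) * len k u) \<le> \<sigma> p"
proof -
  let ?L = "\<lambda>k. {r \<in> late R (S k). fst r = p \<and> arrival R r < u}"
  define A where "A = {k. k < m \<and> ?L k \<noteq> {}}"
  have fin: "finite A"
    by (simp add: A_def)
  have "(\<Sum>k<m. \<Sum>r\<in>?L k. share R (S k) * len k u) = (\<Sum>k\<in>A. \<Sum>r\<in>?L k. share R (S k) * len k u)"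
    by (rule sum.mono_neutral_right) (auto simp: A_def)
  also have "\<dots> \<le> \<sigma> p"
  proof (cases "A = {}")
    case False
    define h where "h = Max A"
    have "h \<in> A"
      unfolding h_def using fin False by (rule Max_in)
    then obtain x where x: "x \<in> late R (S h)" "fst x = p" "arrival R x < u"
      by (auto simp: A_def)
    have xa: "x \<in> alive R (S h)"
      using x(1) late(1) by blast
    then have xr: "x \<in> requests_of n R" "arr_step x \<le> h"
      by (auto simp: alive_def arrived_iff)
    have "(\<Sum>k\<in>A. \<Sum>r\<in>?L k. share R (S k) * len k u) \<le> (\<Sum>k\<in>A. frate R (S k) p * len k u)"
    proof (rule sum_mono)
      fix k
      have "real (card (?L k)) * (share R (S k) * len k u)
          \<le> card {r \<in> late R (S k). fst r = p} * (share R (S k) * len k u)"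
        using share_nonneg[of R "S k"]
        by (intro mult_right_mono mult_nonneg_nonneg of_nat_mono card_mono) (auto simp: len_def)
      then show "(\<Sum>r\<in>?L k. share R (S k) * len k u) \<le> frate R (S k) p * len k u"
        by (simp add: frate_def mult_ac)
    qed
    also have "\<dots> \<le> (\<Sum>k\<in>A. if arr_step x \<le> k then frate R (S k) p * dur k else 0)"
    proof (rule sum_mono)
      fix k
      have "len k u \<le> (if arr_step x \<le> k then dur k else 0)"
      proof (cases "arr_step x \<le> k")
        case True
        then show ?thesis
          using dur_nonneg[of k] by (auto simp: len_def)
      next
        case False
        \<comment> \<open>Steps before the arrival of \<open>x\<close> are over before
          \<open>u\<close> and contribute length 0.\<close>
        then have "T (Suc k) \<le> arrival R x"
          using now_mono[of "Suc k" "arr_step x" R] T_arr_step[OF xr(1)] by simp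
        then have "T (Suc k) - max u (T k) \<le> 0"
          using x(3) by simp
        then show ?thesis
          using False by (simp only: len_def) simp
      qed
      then have "frate R (S k) p * len k u \<le> frate R (S k) p * (if arr_step x \<le> k then dur k else 0)"
        using frate_nonneg by (rule mult_left_mono)
      then show "frate R (S k) p * len k u \<le> (if arr_step x \<le> k then frate R (S k) p * dur k else 0)"
        by (simp split: if_splits)
    qed
    also have "\<dots> = (\<Sum>k\<in>{k\<in>A. arr_step x \<le> k}. frate R (S k) p * dur k)"
      using fin by (simp add: sum.If_cases Int_def)
    also have "\<dots> \<le> (\<Sum>k=arr_step x..h. frate R (S k) p * dur k)"
      using fin unfolding h_def
      by (intro sum_mono2 mult_nonneg_nonneg frate_nonneg dur_nonneg) auto
    also have "\<dots> = (\<Sum>k=arr_step x..h. W (Suc k) p - W k p)"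
      by simp
    also have "\<dots> = W (Suc h) p - W (arr_step x) p"
      using xr(2) by (intro sum_Suc_diff) simp
    also have "\<dots> \<le> \<sigma> p"
      using got_bound[OF xa] got_eq[OF xr] x(2) by simp
    finally show ?thesis .
  qed simp
  finally show ?thesis .
qed

end

section \<open>Fractional schedule against an arbitrary schedule\<close>

text \<open>Tonelli on the half-plane of pairs with \<open>u\<close> at most \<open>t\<close>: a
  charge collected by each \<open>t\<close> from earlier times \<open>u\<close> becomes a payment by
  each \<open>u\<close> for the later times in \<open>A\<close>.\<close>

lemma nn_integral_tail_swap:
  fixes g :: "real \<Rightarrow> ennreal"
  assumes [measurable]: "g \<in> borel_measurable borel" "A \<in> sets borel"
  shows "(\<integral>\<^sup>+t. indicator A t * (\<integral>\<^sup>+u. g u * indicator {..t} u \<partial>lborel) \<partial>lborel) =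
    (\<integral>\<^sup>+u. g u * emeasure lborel (A \<inter> {u..}) \<partial>lborel)"
proof -
  have [measurable]: "(\<lambda>(t, u). indicator A t * (g u * indicator {..t} u) :: ennreal)
      \<in> borel_measurable (lborel \<Otimes>\<^sub>M lborel)"
  proof -
    \<comment> \<open>Joint measurability is visible only if the indicator with moving endpoint is
      rewritten as the indicator of a fixed set of pairs.\<close>
    have "(\<lambda>(t, u). indicator A t * (g u * indicator {x. snd x \<le> fst x} (t, u)) :: ennreal)
        \<in> borel_measurable (lborel \<Otimes>\<^sub>M lborel)"
      by measurable
    moreover have "(indicator {x. snd x \<le> fst x} (t, u) :: ennreal) = indicator {..t} u" for t u :: real
      by (simp add: indicator_def)
    ultimately show ?thesis by simp
  qed
  have "(\<integral>\<^sup>+t. indicator A t * (\<integral>\<^sup>+u. g u * indicator {..t} u \<partial>lborel) \<partial>lborel) =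
      (\<integral>\<^sup>+t. \<integral>\<^sup>+u. indicator A t * (g u * indicator {..t} u) \<partial>lborel \<partial>lborel)"
    by (simp add: nn_integral_cmult)
  also have "\<dots> = (\<integral>\<^sup>+u. \<integral>\<^sup>+t. indicator A t * (g u * indicator {..t} u) \<partial>lborel \<partial>lborel)"
    by (rule lborel_pair.Fubini') simp
  also have "\<dots> = (\<integral>\<^sup>+u. g u * emeasure lborel (A \<inter> {u..}) \<partial>lborel)"
  proof (rule nn_integral_cong)
    fix u
    have "(\<integral>\<^sup>+t. indicator A t * (g u * indicator {..t} u) \<partial>lborel) =
        (\<integral>\<^sup>+t. g u * indicator (A \<inter> {u..}) t \<partial>lborel)"
      by (intro nn_integral_cong) (auto simp: indicator_def)
    then show "(\<integral>\<^sup>+t. indicator A t * (g u * indicator {..t} u) \<partial>lborel) = g u * emeasure lborel (A \<inter> {u..})"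
      by (simp add: nn_integral_cmult_indicator)
  qed
  finally show ?thesis .
qed

definition page_rate :: "schedule \<Rightarrow> nat \<Rightarrow> real \<Rightarrow> ennreal" where
  "page_rate Z p u = ennreal (rate Z u) * indicator {u. 0 \<le> u \<and> fst (transmitted Z u) = p} u"

lemma feasible_measurable:
  assumes "feasible n \<sigma> Z"
  shows "rate Z \<in> borel_measurable borel" "{u. Pr (transmitted Z u)} \<in> sets borel"
    "page_rate Z p \<in> borel_measurable borel"
proof -
  have t: "transmitted Z \<in> measurable borel (count_space UNIV)" and r: "rate Z \<in> borel_measurable borel"
    using assms by (auto simp: feasible_def)
  show "rate Z \<in> borel_measurable borel" by (rule r)
  have *: "{u. Pr (transmitted Z u)} \<in> sets borel" for Pr
  proof -
    have "transmitted Z -` {x. Pr x} \<inter> space borel \<in> sets borel"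
      by (rule measurable_sets[OF t]) simp
    then show ?thesis by (simp add: vimage_def)
  qed
  show "{u. Pr (transmitted Z u)} \<in> sets borel" by (rule *)
  have "{u. 0 \<le> u \<and> fst (transmitted Z u) = p} = {0..} \<inter> {u. fst (transmitted Z u) = p}"
    by auto
  also have "\<dots> \<in> sets borel"
    using *[of "\<lambda>x. fst x = p"] by auto
  finally show "page_rate Z p \<in> borel_measurable borel"
    unfolding page_rate_def[abs_def] using r by measurable
qed

text \<open>The transmission used for piece \<open>k\<close> has no work up to \<open>v k\<close>
  and a full unit by \<open>v (Suc k)\<close>, so the unit is done in the left-open interval between
  them. These intervals are disjoint, and only the total amount of work on the page is kept.\<close>

lemma satisfied_by_work:
  assumes feas: "feasible n \<sigma> Z" and sat: "satisfied_by \<sigma> Z p a f" and "0 \<le> a"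
  shows "of_nat (\<sigma> p) \<le> (\<integral>\<^sup>+u. page_rate Z p u * indicator {a<..f} u \<partial>lborel)"
proof -
  note [measurable] = feasible_measurable(1,3)[OF feas]
  obtain v m where v: "v 0 = a" "v (\<sigma> p) \<le> f"
    and vm: "\<And>k. k < \<sigma> p \<Longrightarrow> v k \<le> v (Suc k)"
      "\<And>k. k < \<sigma> p \<Longrightarrow> work Z (p, k, m k) (v k) = 0"
      "\<And>k. k < \<sigma> p \<Longrightarrow> 1 \<le> work Z (p, k, m k) (v (Suc k))"
    using sat unfolding satisfied_by_def by blast
  have "k \<le> \<sigma> p \<Longrightarrow> v 0 \<le> v k \<and>
      of_nat k \<le> (\<integral>\<^sup>+u. page_rate Z p u * indicator {v 0<..v k} u \<partial>lborel)" for k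
  proof (induction k)
    case 0
    then show ?case by simp
  next
    case (Suc k)
    then have k: "k < \<sigma> p" and IH: "v 0 \<le> v k"
      "of_nat k \<le> (\<integral>\<^sup>+u. page_rate Z p u * indicator {v 0<..v k} u \<partial>lborel)"
      by auto
    let ?j = "(p, k, m k)"
    have [measurable]: "{u. 0 \<le> u \<and> u \<le> t \<and> transmitted Z u = ?j} \<in> sets borel" for t
    proof -
      have "{u. 0 \<le> u \<and> u \<le> t \<and> transmitted Z u = ?j} = {0..t} \<inter> {u. transmitted Z u = ?j}"
        by auto
      then show ?thesis
        using feasible_measurable(2)[OF feas, of "\<lambda>x. x = ?j"] by simp
    qed
    have "1 \<le> work Z ?j (v (Suc k))"
      by (rule vm(3)[OF k])
    also have "\<dots> \<le> (\<integral>\<^sup>+u. ennreal (rate Z u) * indicator {u. 0 \<le> u \<and> u \<le> v k \<and> transmitted Z u = ?j} u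
        + page_rate Z p u * indicator {v k<..v (Suc k)} u \<partial>lborel)"
      unfolding work_def page_rate_def by (intro nn_integral_mono) (auto simp: indicator_def)
    also have "\<dots> = work Z ?j (v k) + (\<integral>\<^sup>+u. page_rate Z p u * indicator {v k<..v (Suc k)} u \<partial>lborel)"
      unfolding work_def by (intro nn_integral_add) measurable
    finally have 1: "1 \<le> (\<integral>\<^sup>+u. page_rate Z p u * indicator {v k<..v (Suc k)} u \<partial>lborel)"
      using vm(2)[OF k] by simp
    have "of_nat (Suc k) \<le> (\<integral>\<^sup>+u. page_rate Z p u * indicator {v 0<..v k} u \<partial>lborel) +
        (\<integral>\<^sup>+u. page_rate Z p u * indicator {v k<..v (Suc k)} u \<partial>lborel)"
      using add_mono[OF IH(2) 1] by (simp add: add.commute)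
    also have "\<dots> = (\<integral>\<^sup>+u. page_rate Z p u * indicator {v 0<..v k} u +
        page_rate Z p u * indicator {v k<..v (Suc k)} u \<partial>lborel)"
      by (intro nn_integral_add[symmetric]) measurable
    also have "\<dots> \<le> (\<integral>\<^sup>+u. page_rate Z p u * indicator {v 0<..v (Suc k)} u \<partial>lborel)"
      using IH(1) vm(1)[OF k] by (intro nn_integral_mono) (auto simp: indicator_def)
    finally show ?case
      using IH(1) vm(1)[OF k] by auto
  qed
  from this[of "\<sigma> p"] have "of_nat (\<sigma> p) \<le> (\<integral>\<^sup>+u. page_rate Z p u * indicator {a<..v (\<sigma> p)} u \<partial>lborel)"
    using v(1) by simp
  also have "\<dots> \<le> (\<integral>\<^sup>+u. page_rate Z p u * indicator {a<..f} u \<partial>lborel)"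
    using v(2) by (intro nn_integral_mono) (auto simp: indicator_def)
  finally show ?thesis .
qed

lemma satisfied_by_mono: "satisfied_by \<sigma> Z p a f \<Longrightarrow> f \<le> g \<Longrightarrow> satisfied_by \<sigma> Z p a g"
  unfolding satisfied_by_def by (elim exE conjE, intro exI conjI) (assumption | erule (1) order_trans)+

lemma satisfied_by_ge:
  assumes "satisfied_by \<sigma> Z p a f"
  shows "a \<le> f"
proof -
  obtain v where v: "v 0 = a" "v (\<sigma> p) \<le> f" "\<And>k. k < \<sigma> p \<Longrightarrow> v k \<le> v (Suc k)"
    using assms unfolding satisfied_by_def by blast
  have "k \<le> \<sigma> p \<Longrightarrow> v 0 \<le> v k" for k
    by (induction k) (use v(3) in \<open>auto intro: order_trans\<close>)
  then show ?thesis
    using v(1,2) by force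
qed

lemma completion_time_ge: "ereal a \<le> completion_time \<sigma> Z p a"
  unfolding completion_time_def by (intro INF_greatest) (auto dest: satisfied_by_ge)

lemma emeasure_lborel_atLeast: "emeasure lborel {a::real..} = \<infinity>"
proof (cases "emeasure lborel {a..}")
  case (real x)
  have "emeasure lborel {a..a + (x + 1)} \<le> emeasure lborel {a..}"
    by (intro emeasure_mono) auto
  then have "ennreal (x + 1) \<le> ennreal x"
    using real by simp
  then show ?thesis
    using real by simp
qed simp

context broadcast_run
begin

definition slot :: "nat \<Rightarrow> real set" where
  "slot k = {T k..<T (Suc k)}"

lemma slot_sets [measurable]: "slot k \<in> sets borel"
  by (simp add: slot_def)

lemma ex_slot:
  assumes "T i \<le> u" "u < T (Suc k)" "i \<le> k"
  shows "\<exists>j. i \<le> j \<and> j \<le> k \<and> u \<in> slot j"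
  using assms(3,2)
proof (induction rule: dec_induct)
  case base
  then show ?case using assms(1) by (auto simp: slot_def)
next
  case (step k)
  show ?case
  proof (cases "u < T (Suc k)")
    case True
    then show ?thesis using step.IH by (meson le_SucI)
  next
    case False
    then show ?thesis using step.prems step.hyps by (intro exI[of _ "Suc k"]) (auto simp: slot_def)
  qed
qed

lemma slot_disjoint: "u \<in> slot j \<Longrightarrow> u \<in> slot k \<Longrightarrow> j = k"
  using now_mono[of "Suc j" k R] now_mono[of "Suc k" j R]
  by (cases j k rule: linorder_cases) (auto simp: slot_def)

lemma sum_slot_le: "(\<Sum>k<m. indicator (slot k) t :: ennreal) \<le> 1"
proof (cases "\<exists>k<m. t \<in> slot k")
  case True
  then obtain k where k: "k < m" "t \<in> slot k" by blast
  then have "t \<notin> slot j" if "j \<noteq> k" for j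
    using slot_disjoint that by blast
  then have "(\<Sum>j<m. indicator (slot j) t :: ennreal) = (\<Sum>j\<in>{k}. indicator (slot j) t)"
    using k(1) by (intro sum.mono_neutral_right) auto
  also have "\<dots> \<le> 1"
    using k(2) by simp
  finally show ?thesis .
qed (simp add: indicator_def)

lemma emeasure_slot: "emeasure lborel (slot k) = ennreal (dur k)"
  using dur_nonneg[of k] by (simp add: slot_def)

lemma emeasure_slot_tail: "emeasure lborel (slot k \<inter> {u..}) = ennreal (len k u)"
proof -
  have "slot k \<inter> {u..} = {max u (T k)..<T (Suc k)}"
    by (auto simp: slot_def)
  then show ?thesis
    by (cases "max u (T k) \<le> T (Suc k)") (auto simp: len_def max_def)
qed

text \<open>The flow time accumulated by the virtual schedule in its first \<open>m\<close> steps,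
  through which both comparisons pass.\<close>

definition alive_cost :: "nat \<Rightarrow> real" where
  "alive_cost m = (\<Sum>k<m. dur k * card (alive R (S k)))"

end

section \<open>Charging late shares to an arbitrary feasible schedule\<close>

locale broadcast_comparison = broadcast_run +
  fixes P :: "real \<Rightarrow> real" and Z :: schedule
  assumes feas: "feasible n \<sigma> Z"
    and P_cont: "continuous_on {0..} P"
    and P_nonneg: "\<And>s. 0 \<le> s \<Longrightarrow> 0 \<le> P s"
    and Q_ratio: "\<And>x s. 0 < x \<Longrightarrow> 0 \<le> s \<Longrightarrow> x / Q x * s \<le> x + P s"
begin

abbreviation completion :: "request \<Rightarrow> ereal" where
  "completion r \<equiv> completion_time \<sigma> Z (fst r) (arrival R r)"

text \<open>The completion time is an infimum that need not be attained. Including it here ensures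
  that the request is satisfied at every later time outside this set, and does not change the
  measure.\<close>

definition open_times :: "request \<Rightarrow> real set" where
  "open_times r = {t. arrival R r \<le> t \<and> ereal t \<le> completion r}"

lemma open_times:
  "open_times r \<in> sets borel" "enn2ereal (emeasure lborel (open_times r)) = completion r - arrival R r"
proof -
  have ge: "ereal (arrival R r) \<le> completion r"
    by (rule completion_time_ge)
  have "open_times r \<in> sets borel \<and>
    enn2ereal (emeasure lborel (open_times r)) = completion r - arrival R r"
  proof (cases "completion r")
    case (real c)
    then have "open_times r = {arrival R r..c}"
      by (auto simp: open_times_def)
    then show ?thesis
      using real ge by simp
  next
    case PInf
    then have "open_times r = {arrival R r..}"
      by (auto simp: open_times_def)
    then show ?thesis
      using PInf by (simp add: emeasure_lborel_atLeast)
  next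
    case MInf
    then show ?thesis
      using ge by simp
  qed
  then show "open_times r \<in> sets borel"
    "enn2ereal (emeasure lborel (open_times r)) = completion r - arrival R r"
    by auto
qed

lemma closed_work:
  assumes "r \<in> requests_of n R" "arrival R r \<le> t" "t \<notin> open_times r"
  shows "of_nat (\<sigma> (fst r)) \<le> (\<integral>\<^sup>+u. page_rate Z (fst r) u * indicator {arrival R r<..t} u \<partial>lborel)"
proof -
  have "completion r < ereal t"
    using assms by (auto simp: open_times_def)
  then obtain f where "satisfied_by \<sigma> Z (fst r) (arrival R r) f" "f < t"
    unfolding completion_time_def INF_less_iff by auto
  then have "satisfied_by \<sigma> Z (fst r) (arrival R r) t"
    using satisfied_by_mono by fastforce
  then show ?thesis
    using satisfied_by_work[OF feas] arrival_nonneg[OF assms(1)] by blast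
qed

text \<open>The weight of the alive count as a function of time, and 0 outside the first
  \<open>m\<close> steps.\<close>

definition step_weight :: "nat \<Rightarrow> real \<Rightarrow> ennreal" where
  "step_weight m u = (\<Sum>j<m. ennreal (weight (card (alive R (S j)))) * indicator (slot j) u)"

lemma step_weight_measurable [measurable]: "step_weight m \<in> borel_measurable borel"
  unfolding step_weight_def[abs_def] by measurable

text \<open>What one late request demands per unit of time in step \<open>k\<close>: its share,
  priced at the weight that \<open>late_weight_le\<close> guarantees at all times since its
  arrival.\<close>

definition late_charge :: "nat \<Rightarrow> real" where
  "late_charge k = share R (S k) * ((1 - \<epsilon> / 12) * weight (card (alive R (S k))))"

lemma late_charge_nonneg: "0 \<le> late_charge k"
  unfolding late_charge_def using share_nonneg weight_nonneg eps by simp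

lemma late_charge_eq:
  assumes "alive R (S k) \<noteq> {}"
  shows "late_charge k * quota R (S k) = (1 + \<epsilon> / 3) * (1 - \<epsilon> / 12) * card (alive R (S k))"
proof -
  have "0 < card (alive R (S k))"
    using assms by (simp add: card_gt_0_iff)
  then have "Q (card (alive R (S k))) \<noteq> 0"
    using Q_pos[of "card (alive R (S k))"] by auto
  then show ?thesis
    using quota_pos[OF assms] by (simp add: late_charge_def share_def weight_def)
qed

lemma quota_late_charge: "(1 + \<epsilon> / 6) * card (alive R (S k)) \<le> quota R (S k) * late_charge k"
proof (cases "alive R (S k) = {}")
  case False
  have "\<epsilon> * \<epsilon> \<le> \<epsilon> * 1"
    using eps by (intro mult_left_mono) auto
  moreover have "(1 + \<epsilon> / 3) * (1 - \<epsilon> / 12) = 1 + \<epsilon> / 4 - \<epsilon> * \<epsilon> / 36"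
    by (simp add: field_simps)
  \<comment> \<open>The surplus is \<epsilon> / 4 - \<epsilon> * \<epsilon> / 36, which for
    \<epsilon> at most 1 is at least 2 / 9 of \<epsilon>.\<close>
  ultimately have "1 + \<epsilon> / 6 \<le> (1 + \<epsilon> / 3) * (1 - \<epsilon> / 12)"
    using eps by linarith
  then have "(1 + \<epsilon> / 6) * card (alive R (S k)) \<le> (1 + \<epsilon> / 3) * (1 - \<epsilon> / 12) * card (alive R (S k))"
    by (rule mult_right_mono) simp
  then show ?thesis
    using late_charge_eq[OF False] by (simp add: mult.commute)
qed (use late_charge_nonneg in simp)

text \<open>All late requests together demand at most 4 / 3 of the alive count, and they number at
  least \<epsilon> / 12 of it, so each one demands at most 16 / \<epsilon>.\<close>

lemma late_charge_le: "late_charge k \<le> 16 / \<epsilon>"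
proof (cases "alive R (S k) = {}")
  case True
  then show ?thesis
    using eps by (simp add: late_charge_def weight_def)
next
  case False
  let ?a = "real (card (alive R (S k)))"
  have a: "0 < ?a"
    using False by (simp add: card_gt_0_iff)
  have "(1 + \<epsilon> / 3) * (1 - \<epsilon> / 12) \<le> 4 / 3 * 1"
    using eps by (intro mult_mono) auto
  then have "(1 + \<epsilon> / 3) * (1 - \<epsilon> / 12) * ?a \<le> 4 / 3 * ?a"
    using a by (intro mult_right_mono) auto
  then have "late_charge k * quota R (S k) \<le> 4 / 3 * ?a"
    by (simp only: late_charge_eq[OF False])
  moreover have "late_charge k * (\<epsilon> / 12 * ?a) \<le> late_charge k * quota R (S k)"
    by (intro mult_left_mono quota_ge late_charge_nonneg)
  ultimately have "late_charge k * (\<epsilon> / 12) * ?a \<le> 4 / 3 * ?a"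
    unfolding mult.assoc by (rule order_trans[rotated])
  then have "late_charge k * (\<epsilon> / 12) \<le> 4 / 3"
    using a by (rule mult_right_le_imp_le)
  then show ?thesis
    using eps by (simp add: field_simps)
qed

text \<open>By time \<open>t\<close> the comparison schedule has spent the size of the page on it
  since the arrival of \<open>r\<close>. At each of these moments the weight is at least
  \<open>1 - \<epsilon> / 12\<close> times the present one, so weighting this work and scaling by
  share over size yields the demanded charge.\<close>

lemma late_charge_closed:
  assumes "k < m" "r \<in> late R (S k)" "t \<in> slot k" "t \<notin> open_times r"
  shows "ennreal (late_charge k) \<le> ennreal (share R (S k) / \<sigma> (fst r)) *
    (\<integral>\<^sup>+u. step_weight m u * page_rate Z (fst r) u * indicator {arrival R r<..} u * indicator {..t} u \<partial>lborel)"
proof -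
  note [measurable] = feasible_measurable(1,3)[OF feas]
  let ?w = "(1 - \<epsilon> / 12) * weight (card (alive R (S k)))"
  have w: "0 \<le> ?w"
    using weight_nonneg eps by simp
  have r: "r \<in> requests_of n R" "arr_step r \<le> k"
    using assms(2) late(1)[of R "S k"] by (auto simp: alive_def arrived_iff)
  have "arrival R r \<le> t"
    using arrival_le_iff[OF r(1), of k] r(2) assms(3) by (auto simp: slot_def)
  note work = closed_work[OF r(1) this assms(4)]
  have pos: "0 < \<sigma> (fst r)"
    using r(1) size_pos by (auto simp: requests_of_def)
  have "ennreal ?w * of_nat (\<sigma> (fst r)) \<le>
      ennreal ?w * (\<integral>\<^sup>+u. page_rate Z (fst r) u * indicator {arrival R r<..t} u \<partial>lborel)"
    by (intro mult_left_mono work) simp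
  also have "\<dots> = (\<integral>\<^sup>+u. ennreal ?w * (page_rate Z (fst r) u * indicator {arrival R r<..t} u) \<partial>lborel)"
    by (intro nn_integral_cmult[symmetric]) measurable
  also have "\<dots> \<le> (\<integral>\<^sup>+u. step_weight m u * page_rate Z (fst r) u * indicator {arrival R r<..} u * indicator {..t} u \<partial>lborel)"
  proof (rule nn_integral_mono)
    fix u
    show "ennreal ?w * (page_rate Z (fst r) u * indicator {arrival R r<..t} u) \<le>
        step_weight m u * page_rate Z (fst r) u * indicator {arrival R r<..} u * indicator {..t} u"
    proof (cases "u \<in> {arrival R r<..t}")
      case True
      then have "T (arr_step r) \<le> u" "u < T (Suc k)"
        using T_arr_step[OF r(1)] assms(3) by (auto simp: slot_def)
      \<comment> \<open>Every moment between the arrival of \<open>r\<close> and \<open>t\<close>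
        lies in a step during which \<open>r\<close> was alive, so the bound on past weights
        applies.\<close>
      then obtain j where j: "arr_step r \<le> j" "j \<le> k" "u \<in> slot j"
        using ex_slot[OF _ _ r(2)] by blast
      have "ennreal ?w \<le> ennreal (weight (card (alive R (S j)))) * indicator (slot j) u"
        using j late_weight_le[OF assms(2) j(1,2)] by (simp add: ennreal_leI)
      also have "\<dots> \<le> step_weight m u"
        unfolding step_weight_def using j assms(1) by (intro member_le_sum) auto
      finally show ?thesis
        using True by (auto intro!: mult_right_mono)
    qed simp
  qed
  finally have "ennreal (share R (S k) / \<sigma> (fst r)) * (ennreal ?w * of_nat (\<sigma> (fst r))) \<le>
      ennreal (share R (S k) / \<sigma> (fst r)) *
      (\<integral>\<^sup>+u. step_weight m u * page_rate Z (fst r) u * indicator {arrival R r<..} u * indicator {..t} u \<partial>lborel)"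
    by (rule mult_left_mono) simp
  moreover have "ennreal (share R (S k) / \<sigma> (fst r)) * (ennreal ?w * of_nat (\<sigma> (fst r))) = ennreal (late_charge k)"
  proof -
    have "ennreal (share R (S k) / \<sigma> (fst r)) * (ennreal ?w * of_nat (\<sigma> (fst r))) =
        ennreal (share R (S k) / \<sigma> (fst r) * (?w * \<sigma> (fst r)))"
      using w share_nonneg[of R "S k"]
      by (simp only: ennreal_of_nat_eq_real_of_nat) (simp only: ennreal_mult[symmetric]
        divide_nonneg_nonneg mult_nonneg_nonneg of_nat_0_le_iff)
    also have "share R (S k) / \<sigma> (fst r) * (?w * \<sigma> (fst r)) = late_charge k"
      using pos by (simp add: late_charge_def)
    finally show ?thesis .
  qed
  ultimately show ?thesis by simp
qed

lemma step_weight_rate_le: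
  "step_weight m u * (ennreal (rate Z u) * indicator {0..} u) \<le>
    (\<Sum>j<m. ennreal (card (alive R (S j))) * indicator (slot j) u) + ennreal (P (rate Z u)) * indicator {0..} u"
proof (cases "(\<exists>j<m. u \<in> slot j) \<and> 0 \<le> u")
  case True
  then obtain j where j: "j < m" "u \<in> slot j" by blast
  have notin: "u \<notin> slot i" if "i \<noteq> j" for i
    using slot_disjoint that j(2) by blast
  have sum: "(\<Sum>i<m. f i * indicator (slot i) u :: ennreal) = f j" for f
  proof -
    have "(\<Sum>i<m. f i * indicator (slot i) u) = (\<Sum>i\<in>{j}. f i * indicator (slot i) u)"
      using j(1) notin by (intro sum.mono_neutral_right) auto
    then show ?thesis using j by simp
  qed
  have nn: "0 \<le> rate Z u"
    using feas by (simp add: feasible_def)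
  let ?a = "card (alive R (S j))"
  have "weight ?a * rate Z u \<le> ?a + P (rate Z u)"
    using Q_ratio[of ?a "rate Z u"] nn P_nonneg[OF nn] by (cases "?a = 0") (auto simp: weight_def)
  then have "ennreal (weight ?a * rate Z u) \<le> ennreal (?a + P (rate Z u))"
    by (rule ennreal_leI)
  then show ?thesis
    using True nn P_nonneg[OF nn] weight_nonneg by (simp add: step_weight_def sum ennreal_mult)
next
  case False
  then have "step_weight m u * (ennreal (rate Z u) * indicator {0..} u) = 0"
    by (cases "0 \<le> u") (auto simp: step_weight_def intro!: sum.neutral)
  then show ?thesis
    by (simp only: zero_le)
qed

lemma sum_page_rate_le: "(\<Sum>p<n. page_rate Z p u) \<le> ennreal (rate Z u) * indicator {0..} u"
proof -
  have "(\<Sum>p<n. page_rate Z p u) =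
      (\<Sum>p<n. if p = fst (transmitted Z u) then ennreal (rate Z u) * indicator {0..} u else 0)"
    by (intro sum.cong) (auto simp: page_rate_def indicator_def)
  then show ?thesis by simp
qed

text \<open>
  Exchanging the two integrals charges late shares given to closed requests to the work of the
  comparison schedule; \<open>future_share_le\<close> bounds what a unit of that work receives.
\<close>

lemma closed_charge_le:
  "(\<Sum>k<m. \<Sum>r\<in>late R (S k). \<integral>\<^sup>+t. indicator (slot k) t * (ennreal (share R (S k) / \<sigma> (fst r)) *
      (\<integral>\<^sup>+u. step_weight m u * page_rate Z (fst r) u * indicator {arrival R r<..} u * indicator {..t} u \<partial>lborel)) \<partial>lborel)
    \<le> ennreal (alive_cost m) + energy P 1 Z"
proof -
  note [measurable] = feasible_measurable(1,3)[OF feas]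
  let ?g = "\<lambda>r u. step_weight m u * page_rate Z (fst r) u * indicator {arrival R r<..} u"
  have "(\<integral>\<^sup>+t. indicator (slot k) t * (ennreal (share R (S k) / \<sigma> (fst r)) *
      (\<integral>\<^sup>+u. ?g r u * indicator {..t} u \<partial>lborel)) \<partial>lborel) =
      (\<integral>\<^sup>+u. ennreal (share R (S k) / \<sigma> (fst r)) * (?g r u * ennreal (len k u)) \<partial>lborel)" for k r
  proof -
    have "(\<integral>\<^sup>+t. indicator (slot k) t * (ennreal (share R (S k) / \<sigma> (fst r)) *
        (\<integral>\<^sup>+u. ?g r u * indicator {..t} u \<partial>lborel)) \<partial>lborel) =
        (\<integral>\<^sup>+t. indicator (slot k) t *
        (\<integral>\<^sup>+u. (ennreal (share R (S k) / \<sigma> (fst r)) * ?g r u) * indicator {..t} u \<partial>lborel) \<partial>lborel)"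
      by (simp add: nn_integral_cmult mult.assoc)
    also have "\<dots> = (\<integral>\<^sup>+u. (ennreal (share R (S k) / \<sigma> (fst r)) * ?g r u) * ennreal (len k u) \<partial>lborel)"
      by (subst nn_integral_tail_swap) (auto simp: emeasure_slot_tail)
    finally show ?thesis by (simp add: mult.assoc)
  qed
  then have "(\<Sum>k<m. \<Sum>r\<in>late R (S k). \<integral>\<^sup>+t. indicator (slot k) t * (ennreal (share R (S k) / \<sigma> (fst r)) *
      (\<integral>\<^sup>+u. ?g r u * indicator {..t} u \<partial>lborel)) \<partial>lborel) =
      (\<Sum>k<m. \<Sum>r\<in>late R (S k). \<integral>\<^sup>+u. ennreal (share R (S k) / \<sigma> (fst r)) * (?g r u * ennreal (len k u)) \<partial>lborel)"
    by simp
  also have "\<dots> = (\<integral>\<^sup>+u. (\<Sum>k<m. \<Sum>r\<in>late R (S k). ennreal (share R (S k) / \<sigma> (fst r)) * (?g r u * ennreal (len k u))) \<partial>lborel)"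
    unfolding len_def by (simp add: nn_integral_sum)
  also have "\<dots> \<le> (\<integral>\<^sup>+u. (\<Sum>j<m. ennreal (card (alive R (S j))) * indicator (slot j) u) + ennreal (P (rate Z u)) * indicator {0..} u \<partial>lborel)"
  proof (rule nn_integral_mono)
    fix u
    let ?L = "\<lambda>k p. {r \<in> late R (S k). fst r = p \<and> arrival R r < u}"
    have "(\<Sum>r\<in>late R (S k). ennreal (share R (S k) / \<sigma> (fst r)) * (?g r u * ennreal (len k u))) =
        (\<Sum>p<n. \<Sum>r\<in>?L k p. ennreal (share R (S k) / \<sigma> p) * (step_weight m u * page_rate Z p u * ennreal (len k u)))" for k
    proof -
      have "(\<Sum>r\<in>late R (S k). ennreal (share R (S k) / \<sigma> (fst r)) * (?g r u * ennreal (len k u))) =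
        (\<Sum>r\<in>{r \<in> late R (S k). arrival R r < u}. ennreal (share R (S k) / \<sigma> (fst r)) *
          (step_weight m u * page_rate Z (fst r) u * ennreal (len k u)))"
        by (intro sum.mono_neutral_cong_right) (auto simp: indicator_def)
      also have "\<dots> = (\<Sum>p<n. \<Sum>r\<in>{r \<in> {r \<in> late R (S k). arrival R r < u}. fst r = p}.
          ennreal (share R (S k) / \<sigma> (fst r)) * (step_weight m u * page_rate Z (fst r) u * ennreal (len k u)))"
        using late(1)[of R "S k"]
        by (intro sum.group[symmetric]) (auto simp: alive_def arrived_requests_def requests_of_def)
      also have "\<dots> = (\<Sum>p<n. \<Sum>r\<in>?L k p. ennreal (share R (S k) / \<sigma> p) * (step_weight m u * page_rate Z p u * ennreal (len k u)))"
        by (intro sum.cong) auto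
      finally show ?thesis .
    qed
    then have "(\<Sum>k<m. \<Sum>r\<in>late R (S k). ennreal (share R (S k) / \<sigma> (fst r)) * (?g r u * ennreal (len k u))) =
        (\<Sum>k<m. \<Sum>p<n. \<Sum>r\<in>?L k p. ennreal (share R (S k) / \<sigma> p) * (step_weight m u * page_rate Z p u * ennreal (len k u)))"
      by simp
    also have "\<dots> = (\<Sum>p<n. \<Sum>k<m. \<Sum>r\<in>?L k p. ennreal (share R (S k) / \<sigma> p) * (step_weight m u * page_rate Z p u * ennreal (len k u)))"
      by (rule sum.swap)
    also have "\<dots> = (\<Sum>p<n. step_weight m u * page_rate Z p u *
        (\<Sum>k<m. \<Sum>r\<in>?L k p. ennreal (share R (S k) / \<sigma> p) * ennreal (len k u)))"
      by (simp only: sum_distrib_left mult_ac)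
    \<comment> \<open>For fixed \<open>u\<close> and \<open>p\<close> the bracket is the future
      shares of older late requests divided by the page size, hence at most 1: a unit of work pays
      its weight at most once.\<close>
    also have "\<dots> \<le> (\<Sum>p<n. step_weight m u * page_rate Z p u * 1)"
    proof (intro sum_mono mult_left_mono)
      fix p assume "p \<in> {..<n}"
      then have p: "p < n" by simp
      have nn: "0 \<le> share R (S k) * len k u" for k
        using share_nonneg[of R "S k"] by (simp add: len_def)
      have "(\<Sum>k<m. \<Sum>r\<in>?L k p. ennreal (share R (S k) / \<sigma> p) * ennreal (len k u)) =
          (\<Sum>k<m. \<Sum>r\<in>?L k p. ennreal (share R (S k) * len k u / \<sigma> p))"
        using share_nonneg by (intro sum.cong) (auto simp: ennreal_mult[symmetric] len_def)
      also have "\<dots> = ennreal (\<Sum>k<m. \<Sum>r\<in>?L k p. share R (S k) * len k u / \<sigma> p)"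
        using nn by (simp add: sum_nonneg del: sum_constant)
      also have "(\<Sum>k<m. \<Sum>r\<in>?L k p. share R (S k) * len k u / \<sigma> p) =
          (\<Sum>k<m. \<Sum>r\<in>?L k p. share R (S k) * len k u) / \<sigma> p"
        by (simp only: sum_divide_distrib)
      also have "ennreal \<dots> \<le> ennreal 1"
        using future_share_le[OF p, where m = m and u = u] size_pos[OF p] by (intro ennreal_leI) simp
      finally show "(\<Sum>k<m. \<Sum>r\<in>?L k p. ennreal (share R (S k) / \<sigma> p) * ennreal (len k u)) \<le> 1"
        by simp
    qed simp
    also have "\<dots> = step_weight m u * (\<Sum>p<n. page_rate Z p u)"
      by (simp add: sum_distrib_left)
    also have "\<dots> \<le> step_weight m u * (ennreal (rate Z u) * indicator {0..} u)"
      by (intro mult_left_mono sum_page_rate_le) simp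
    also have "\<dots> \<le> (\<Sum>j<m. ennreal (card (alive R (S j))) * indicator (slot j) u) + ennreal (P (rate Z u)) * indicator {0..} u"
      by (rule step_weight_rate_le)
    finally show "(\<Sum>k<m. \<Sum>r\<in>late R (S k). ennreal (share R (S k) / \<sigma> (fst r)) * (?g r u * ennreal (len k u))) \<le> \<dots>" .
  qed
  also have "\<dots> = (\<integral>\<^sup>+u. (\<Sum>j<m. ennreal (card (alive R (S j))) * indicator (slot j) u) \<partial>lborel) + energy P 1 Z"
  proof -
    \<comment> \<open>\<open>P\<close> is known to be continuous only on nonnegative speeds;
      composing with \<open>max 0\<close> gives a measurable function that agrees with it on all
      rates.\<close>
    have "continuous_on UNIV (\<lambda>x. P (max 0 x))"
      by (rule continuous_on_compose2[OF P_cont]) (intro continuous_on_max continuous_on_const continuous_on_id, auto)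
    then have [measurable]: "(\<lambda>x. P (max 0 x)) \<in> borel_measurable borel"
      by (rule borel_measurable_continuous_onI)
    have "(\<lambda>u. P (max 0 (rate Z u))) \<in> borel_measurable borel"
      by measurable
    moreover have "(\<lambda>u. P (max 0 (rate Z u))) = (\<lambda>u. P (rate Z u))"
      using feas by (simp add: feasible_def)
    ultimately have [measurable]: "(\<lambda>u. P (rate Z u)) \<in> borel_measurable borel"
      by simp
    show ?thesis
      unfolding energy_def div_by_1 by (rule nn_integral_add) measurable
  qed
  also have "(\<integral>\<^sup>+u. (\<Sum>j<m. ennreal (card (alive R (S j))) * indicator (slot j) u) \<partial>lborel) = ennreal (alive_cost m)"
  proof -
    have "(\<integral>\<^sup>+u. (\<Sum>j<m. ennreal (card (alive R (S j))) * indicator (slot j) u) \<partial>lborel) =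
        (\<Sum>j<m. \<integral>\<^sup>+u. ennreal (card (alive R (S j))) * indicator (slot j) u \<partial>lborel)"
      by (rule nn_integral_sum) measurable
    also have "\<dots> = (\<Sum>j<m. ennreal (card (alive R (S j))) * ennreal (dur j))"
      by (intro sum.cong refl) (simp only: nn_integral_cmult_indicator slot_sets sets_lborel emeasure_slot)
    also have "\<dots> = (\<Sum>j<m. ennreal (dur j * card (alive R (S j))))"
      using dur_nonneg by (intro sum.cong) (auto simp: ennreal_mult[symmetric] mult.commute)
    also have "\<dots> = ennreal (alive_cost m)"
      unfolding alive_cost_def using dur_nonneg by (intro sum_ennreal) auto
    finally show ?thesis .
  qed
  finally show ?thesis .
qed

text \<open>At each time the late requests demand at least \<open>1 + \<epsilon> / 6\<close> times
  the alive count. Those still open in the comparison schedule are paid by its flow time, 16 /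
  \<epsilon> each; the closed ones cost at most \<open>alive_cost\<close> plus its energy.
  Cancelling \<open>alive_cost\<close> leaves the surplus.\<close>

lemma alive_cost_le:
  "ennreal (\<epsilon> / 6 * alive_cost m) \<le>
    energy P 1 Z + ennreal (16 / \<epsilon>) * (\<Sum>r\<in>requests_of n R. emeasure lborel (open_times r))"
proof -
  note [measurable] = feasible_measurable(1,3)[OF feas] open_times(1)
  let ?F = "ennreal (16 / \<epsilon>) * (\<Sum>r\<in>requests_of n R. emeasure lborel (open_times r))"
  let ?g = "\<lambda>r u. step_weight m u * page_rate Z (fst r) u * indicator {arrival R r<..} u"
  let ?c = "\<lambda>k r t. ennreal (share R (S k) / \<sigma> (fst r)) * (\<integral>\<^sup>+u. ?g r u * indicator {..t} u \<partial>lborel)"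
  have meas[measurable]: "(\<lambda>t. ?c k r t) \<in> borel_measurable borel" for k r
  proof -
    have "(\<lambda>(t, u). ?g r u * indicator {x. snd x \<le> fst x} (t, u)) \<in> borel_measurable (borel \<Otimes>\<^sub>M lborel)"
      by measurable
    moreover have "(indicator {x. snd x \<le> fst x} (t, u) :: ennreal) = indicator {..t} u" for t u :: real
      by (simp add: indicator_def)
    ultimately have "(\<lambda>(t, u). ?g r u * indicator {..t} u) \<in> borel_measurable (borel \<Otimes>\<^sub>M lborel)"
      by simp
    then have "(\<lambda>t. \<integral>\<^sup>+u. ?g r u * indicator {..t} u \<partial>lborel) \<in> borel_measurable borel"
      by (rule lborel.borel_measurable_nn_integral)
    then show ?thesis by measurable
  qed
  have pt: "indicator (slot k) t * ennreal ((1 + \<epsilon> / 6) * card (alive R (S k))) \<le>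
      (\<Sum>r\<in>late R (S k). indicator (slot k) t * ?c k r t) +
      indicator (slot k) t * (ennreal (16 / \<epsilon>) * (\<Sum>r\<in>requests_of n R. indicator (open_times r) t))"
    if "k < m" for k t
  proof (cases "t \<in> slot k")
    case True
    have "ennreal ((1 + \<epsilon> / 6) * card (alive R (S k))) \<le> ennreal (quota R (S k) * late_charge k)"
      by (intro ennreal_leI quota_late_charge)
    also have "\<dots> = (\<Sum>r\<in>late R (S k). ennreal (late_charge k))"
      using late_charge_nonneg by (simp add: late(2) ennreal_mult ennreal_of_nat_eq_real_of_nat)
    also have "\<dots> \<le> (\<Sum>r\<in>late R (S k). ?c k r t + ennreal (16 / \<epsilon>) * indicator (open_times r) t)"
    proof (rule sum_mono)
      fix r assume r: "r \<in> late R (S k)"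
      show "ennreal (late_charge k) \<le> ?c k r t + ennreal (16 / \<epsilon>) * indicator (open_times r) t"
      proof (cases "t \<in> open_times r")
        case True
        then have "ennreal (late_charge k) \<le> ennreal (16 / \<epsilon>) * indicator (open_times r) t"
          using late_charge_le by (simp add: ennreal_leI)
        then show ?thesis
          by (simp add: add_increasing)
      next
        case False
        then show ?thesis
          using late_charge_closed[OF that r True] by simp
      qed
    qed
    also have "\<dots> = (\<Sum>r\<in>late R (S k). ?c k r t) + ennreal (16 / \<epsilon>) * (\<Sum>r\<in>late R (S k). indicator (open_times r) t)"
      by (simp only: sum.distrib sum_distrib_left)
    also have "\<dots> \<le> (\<Sum>r\<in>late R (S k). ?c k r t) + ennreal (16 / \<epsilon>) * (\<Sum>r\<in>requests_of n R. indicator (open_times r) t)"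
      using late(1)[of R "S k"]
      by (intro add_left_mono mult_left_mono sum_mono2) (auto simp: alive_def arrived_requests_def)
    finally show ?thesis
      using True by simp
  qed simp
  have "ennreal ((1 + \<epsilon> / 6) * alive_cost m) = (\<Sum>k<m. \<integral>\<^sup>+t. indicator (slot k) t * ennreal ((1 + \<epsilon> / 6) * card (alive R (S k))) \<partial>lborel)"
  proof -
    have "(\<Sum>k<m. \<integral>\<^sup>+t. indicator (slot k) t * ennreal ((1 + \<epsilon> / 6) * card (alive R (S k))) \<partial>lborel) =
        (\<Sum>k<m. ennreal ((1 + \<epsilon> / 6) * (dur k * card (alive R (S k)))))"
      using dur_nonneg eps
      by (intro sum.cong)
        (auto simp: nn_integral_multc emeasure_slot ennreal_mult[symmetric] mult_ac)
    also have "\<dots> = ennreal (\<Sum>k<m. (1 + \<epsilon> / 6) * (dur k * card (alive R (S k))))"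
      using dur_nonneg eps by (intro sum_ennreal) auto
    finally show ?thesis
      by (simp add: alive_cost_def sum_distrib_left)
  qed
  also have "\<dots> \<le> (\<Sum>k<m. \<integral>\<^sup>+t. (\<Sum>r\<in>late R (S k). indicator (slot k) t * ?c k r t) +
      indicator (slot k) t * (ennreal (16 / \<epsilon>) * (\<Sum>r\<in>requests_of n R. indicator (open_times r) t)) \<partial>lborel)"
    by (intro sum_mono nn_integral_mono pt) simp
  also have "\<dots> = (\<Sum>k<m. (\<Sum>r\<in>late R (S k). \<integral>\<^sup>+t. indicator (slot k) t * ?c k r t \<partial>lborel) +
      (\<integral>\<^sup>+t. indicator (slot k) t * (ennreal (16 / \<epsilon>) * (\<Sum>r\<in>requests_of n R. indicator (open_times r) t)) \<partial>lborel))"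
    by (intro sum.cong refl) (subst nn_integral_add, (measurable; fail)+, subst nn_integral_sum, auto)
  also have "\<dots> = (\<Sum>k<m. \<Sum>r\<in>late R (S k). \<integral>\<^sup>+t. indicator (slot k) t * ?c k r t \<partial>lborel) +
      (\<Sum>k<m. \<integral>\<^sup>+t. indicator (slot k) t * (ennreal (16 / \<epsilon>) * (\<Sum>r\<in>requests_of n R. indicator (open_times r) t)) \<partial>lborel)"
    by (rule sum.distrib)
  also have "(\<Sum>k<m. \<integral>\<^sup>+t. indicator (slot k) t * (ennreal (16 / \<epsilon>) * (\<Sum>r\<in>requests_of n R. indicator (open_times r) t)) \<partial>lborel) =
      (\<integral>\<^sup>+t. (\<Sum>k<m. indicator (slot k) t * (ennreal (16 / \<epsilon>) * (\<Sum>r\<in>requests_of n R. indicator (open_times r) t))) \<partial>lborel)"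
    by (rule nn_integral_sum[symmetric]) measurable
  also have "\<dots> = (\<integral>\<^sup>+t. (\<Sum>k<m. indicator (slot k) t) * (ennreal (16 / \<epsilon>) * (\<Sum>r\<in>requests_of n R. indicator (open_times r) t)) \<partial>lborel)"
    by (simp only: sum_distrib_right)
  also have "\<dots> \<le> (\<integral>\<^sup>+t. 1 * (ennreal (16 / \<epsilon>) * (\<Sum>r\<in>requests_of n R. indicator (open_times r) t)) \<partial>lborel)"
    by (intro nn_integral_mono mult_right_mono sum_slot_le) simp
  also have "\<dots> = ?F"
    by (simp add: nn_integral_cmult nn_integral_sum)
  finally have "ennreal ((1 + \<epsilon> / 6) * alive_cost m) \<le>
      (\<Sum>k<m. \<Sum>r\<in>late R (S k). \<integral>\<^sup>+t. indicator (slot k) t * ?c k r t \<partial>lborel) + ?F"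
    by (simp add: add_left_mono)
  also have "\<dots> \<le> ennreal (alive_cost m) + energy P 1 Z + ?F"
    by (intro add_right_mono closed_charge_le)
  finally have le: "ennreal ((1 + \<epsilon> / 6) * alive_cost m) \<le> ennreal (alive_cost m) + (energy P 1 Z + ?F)"
    by (simp add: add.assoc)
  have nn: "0 \<le> alive_cost m"
    unfolding alive_cost_def using dur_nonneg by (intro sum_nonneg) auto
  have "ennreal ((1 + \<epsilon> / 6) * alive_cost m) = ennreal (alive_cost m) + ennreal (\<epsilon> / 6 * alive_cost m)"
    using nn eps by (simp add: ennreal_plus[symmetric] distrib_right del: ennreal_plus)
  \<comment> \<open>Cancellation is legitimate because \<open>ennreal (alive_cost m)\<close> is
    finite.\<close>
  then show ?thesis
    using le by (simp add: ennreal_add_left_cancel_le)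
qed

end

section \<open>Feasibility and cost of the real schedule\<close>

text \<open>Supplies the moments separating consecutive pieces. First moments are needed, since
  before them the next piece must not have been touched; they exist as minima of compact level
  sets.\<close>

lemma first_time:
  fixes H :: "real \<Rightarrow> real"
  assumes cont: "continuous_on UNIV H" and mono: "\<And>x y. x \<le> y \<Longrightarrow> H x \<le> H y"
    and "H a < y" "y \<le> H b"
  shows "\<exists>x. x \<le> b \<and> H x = y \<and> (\<forall>t<x. H t < y)"
proof -
  have ab: "a \<le> b"
    using assms mono[of b a] by linarith
  have ivt: "\<exists>x\<ge>a. x \<le> t \<and> H x = y" if "y \<le> H t" for t
  proof -
    have "a \<le> t"
      using assms(3) that mono[of t a] by linarith
    then show ?thesis
      using that assms(3) by (intro IVT') (auto intro: continuous_on_subset[OF cont])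
  qed
  have c: "compact ({a..b} \<inter> H -` {y})"
    by (intro compact_Int_closed compact_Icc closed_vimage closed_singleton cont)
  have ne: "{a..b} \<inter> H -` {y} \<noteq> {}"
    using ivt[OF assms(4)] by auto
  obtain x where x: "x \<in> {a..b} \<inter> H -` {y}" "\<forall>t\<in>{a..b} \<inter> H -` {y}. x \<le> t"
    using compact_attains_inf[OF c ne] by blast
  have "H t < y" if "t < x" for t
  proof (rule ccontr)
    assume "\<not> H t < y"
    then obtain z where "a \<le> z" "z \<le> t" "H z = y"
      using ivt[of t] by auto
    moreover from this have "z \<in> {a..b} \<inter> H -` {y}"
      using x(1) that by auto
    ultimately show False
      using x(2) that by force
  qed
  then show ?thesis
    using x(1) by auto
qed

context broadcast_run
begin

lemma busy_iff: "busy R t k \<longleftrightarrow> t \<in> slot k \<and> waiting R (S k) \<noteq> {}"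
  by (auto simp: busy_def slot_def)

lemma busy_less_last: "busy R t k \<Longrightarrow> k < last_step"
  using gaps_empty_trajectory[OF gaps_last_step, of k] gaps_empty(2) by (force simp: busy_iff not_less[symmetric])

lemma sum_slot:
  assumes "finite A" "k \<in> A" "t \<in> slot k"
  shows "(\<Sum>j\<in>A. f j * indicator (slot j) t) = (f k :: 'b :: semiring_1)"
proof -
  have "t \<notin> slot j" if "j \<noteq> k" for j
    using slot_disjoint that assms(3) by blast
  then have "(\<Sum>j\<in>A. f j * indicator (slot j) t) = (\<Sum>j\<in>{k}. f j * indicator (slot j) t)"
    using assms by (intro sum.mono_neutral_right) auto
  then show ?thesis
    using assms(3) by simp
qed

lemma rate_sched: "rate (sched R) t = (\<Sum>k<last_step. speed R (S k) * indicator (slot k) t)"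
proof (cases "\<exists>k. busy R t k")
  case True
  then obtain k where k: "busy R t k" by blast
  then have "(\<Sum>k<last_step. speed R (S k) * indicator (slot k) t) = speed R (S k)"
    using busy_less_last[OF k] by (intro sum_slot) (auto simp: busy_iff)
  then show ?thesis
    using sched_busy[OF k] by simp
next
  case False
  then have "(\<Sum>k<last_step. speed R (S k) * indicator (slot k) t) = 0"
    by (intro sum.neutral) (auto simp: busy_iff speed_def indicator_def)
  then show ?thesis
    using False by (simp add: sched_def)
qed

lemma transmitted_sched_vimage: "{t. transmitted (sched R) t = j} \<in> sets borel"
proof -
  let ?p = "\<lambda>k. fst (newest_waiting R (S k))"
  let ?g = "\<lambda>k t. (?p k, nat \<lfloor>progress (S k) (?p k) + speed R (S k) * (t - T k)\<rfloor>, index (S k) (?p k))"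
  let ?B = "{k. k < last_step \<and> waiting R (S k) \<noteq> {}}"
  \<comment> \<open>An idle server shows the triple \<open>(0, 0, 0)\<close> at rate 0, so the
    preimage of that triple also contains all idle times.\<close>
  have eq: "{t. transmitted (sched R) t = j} =
      (\<Union>k\<in>?B. slot k \<inter> {t. ?g k t = j}) \<union> (if j = (0, 0, 0) then - (\<Union>k\<in>?B. slot k) else {})"
  proof (rule set_eqI)
    fix t
    show "t \<in> {t. transmitted (sched R) t = j} \<longleftrightarrow> t \<in>
      (\<Union>k\<in>?B. slot k \<inter> {t. ?g k t = j}) \<union> (if j = (0, 0, 0) then - (\<Union>k\<in>?B. slot k) else {})"
    proof (cases "\<exists>k. busy R t k")
      case True
      then obtain k where k: "busy R t k" by blast
      then have tk: "t \<in> slot k" and kB: "k \<in> ?B"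
        using busy_less_last by (auto simp: busy_iff)
      have "t \<in> (\<Union>k\<in>?B. slot k \<inter> {t. ?g k t = j}) \<longleftrightarrow> ?g k t = j"
        using tk kB slot_disjoint[OF tk] by blast
      moreover have "t \<notin> - (\<Union>k\<in>?B. slot k)"
        using tk kB by blast
      moreover have "transmitted (sched R) t = ?g k t"
        using sched_busy[OF k] by simp
      ultimately show ?thesis
        by (auto simp only: mem_Collect_eq Un_iff empty_iff split: if_splits)
    next
      case False
      then have "t \<notin> (\<Union>k\<in>?B. slot k)"
        by (auto simp: busy_iff)
      moreover have "transmitted (sched R) t = (0, 0, 0)"
        using False by (simp add: sched_def)
      ultimately show ?thesis
        by auto
    qed
  qed
  have meas: "slot k \<inter> {t. ?g k t = j} \<in> sets borel" for k
  proof -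
    have "{t. nat \<lfloor>a + b * (t - c)\<rfloor> = i} \<in> sets borel" for a b c :: real and i
      by measurable
    moreover have "{t. ?g k t = j} = (if ?p k = fst j \<and> index (S k) (?p k) = snd (snd j)
        then {t. nat \<lfloor>progress (S k) (?p k) + speed R (S k) * (t - T k)\<rfloor> = fst (snd j)} else {})"
      by (cases j) auto
    ultimately show ?thesis
      by simp
  qed
  have fin: "finite ?B"
    by simp
  have "(\<Union>k\<in>?B. slot k \<inter> {t. ?g k t = j}) \<in> sets borel"
    by (rule sets.finite_UN[OF fin]) (rule meas)
  moreover have "- (\<Union>k\<in>?B. slot k) \<in> sets borel"
    by (intro borel_comp sets.finite_UN[OF fin] slot_sets)
  ultimately show ?thesis
    unfolding eq by (intro sets.Un) (assumption, cases "j = (0, 0, 0)",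
      simp_all only: refl if_True if_False sets.empty_sets)
qed

text \<open>Slots are half open: strictly before the end of the step less than the full page has
  been sent, so the integer part is a legal piece number.\<close>

lemma piece_bounds:
  assumes "t \<in> slot k" "waiting R (S k) \<noteq> {}" "p = fst (newest_waiting R (S k))"
  shows "0 \<le> progress (S k) p + speed R (S k) * (t - T k)"
    "progress (S k) p + speed R (S k) * (t - T k) < \<sigma> p"
proof -
  have "0 \<le> progress (S k) p"
    using invar_trajectory[of R k] by (simp add: invar_def)
  then show "0 \<le> progress (S k) p + speed R (S k) * (t - T k)"
    using assms(1) speed_nonneg[of R "S k"] by (simp add: slot_def)
  have "speed R (S k) * (t - T k) < speed R (S k) * dur k"
    using assms(1) speed_pos[OF assms(2)] by (intro mult_strict_left_mono) (auto simp: slot_def)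
  then show "progress (S k) p + speed R (S k) * (t - T k) < \<sigma> p"
    using progress_bound[OF invar_trajectory, of R k p] assms(3) by (simp add: prate_def)
qed

lemma sched_feasible: "feasible n \<sigma> (sched R)"
  unfolding feasible_def
proof (intro conjI allI impI)
  show "rate (sched R) \<in> borel_measurable borel"
    unfolding rate_sched by measurable
  show "transmitted (sched R) \<in> measurable borel (count_space UNIV)"
    unfolding measurable_count_space_eq2_countable
    using transmitted_sched_vimage by (auto simp: vimage_def)
  show "0 \<le> rate (sched R) t" for t
    unfolding rate_sched using speed_nonneg by (intro sum_nonneg) auto
  fix t p k m
  assume *: "0 < rate (sched R) t" "transmitted (sched R) t = (p, k, m)"
  then obtain j where j: "busy R t j"
    by (auto simp: sched_def split: if_splits)
  then have w: "t \<in> slot j" "waiting R (S j) \<noteq> {}"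
    by (auto simp: busy_iff)
  have p: "p = fst (newest_waiting R (S j))"
    "k = nat \<lfloor>progress (S j) p + speed R (S j) * (t - T j)\<rfloor>"
    using * sched_busy[OF j] by auto
  show "p < n"
    using newest_low_mark(1)[OF w(2)] p(1) by (simp add: requests_of_def)
  show "k < \<sigma> p"
    using piece_bounds[OF w p(1)] p(2) by linarith
qed

section \<open>Completed transmissions satisfy the requests they cover\<close>

definition sent :: "nat \<Rightarrow> nat \<Rightarrow> nat \<Rightarrow> real" where
  "sent p i k = (if index (S k) p = i then prate R (S k) p else 0)"

text \<open>The amount of transmission \<open>i\<close> of page \<open>p\<close> sent by time
  \<open>t\<close>; the clamped difference is the part of step \<open>k\<close> before
  \<open>t\<close>. As a function of \<open>t\<close> it is continuous and monotone.\<close>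

definition sent_until :: "nat \<Rightarrow> nat \<Rightarrow> nat \<Rightarrow> real \<Rightarrow> real" where
  "sent_until p i m t = (\<Sum>k<m. sent p i k * (max (T k) (min t (T (Suc k))) - T k))"

lemma sent_nonneg: "0 \<le> sent p i k"
  by (simp add: sent_def prate_nonneg)

lemma index_mono: "j \<le> k \<Longrightarrow> index (S j) p \<le> index (S k) p"
  by (induction rule: dec_induct) auto

lemma start_le: "start (S k) p \<le> T k"
  using invar_trajectory[of R k] by (simp add: invar_def)

lemma start_eq:
  "j \<le> k \<Longrightarrow> index (S j) p = index (S k) p \<Longrightarrow> start (S j) p = start (S k) p"
proof (induction rule: dec_induct)
  case (step k)
  then have "\<not> restart R (S k) p"
    using index_mono[of j k p] by auto
  then show ?case
    using step by simp
qed simp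

text \<open>Allowing \<open>i\<close> to be a future transmission, of which nothing has been sent,
  is what the induction needs when a restart raises the index to \<open>i\<close>.\<close>

lemma sum_sent:
  "index (S k) p \<le> i \<Longrightarrow>
     (\<Sum>j<k. sent p i j * dur j) = (if index (S k) p = i then progress (S k) p else 0)"
proof (induction k)
  case (Suc k)
  then show ?case
    using index_mono[of k "Suc k" p] by (auto simp: sent_def split: if_splits)
qed simp

lemma sent_until_mono: "x \<le> y \<Longrightarrow> sent_until p i m x \<le> sent_until p i m y"
  unfolding sent_until_def by (intro sum_mono mult_left_mono sent_nonneg) auto

lemma sent_until_continuous: "continuous_on UNIV (sent_until p i m)"
  unfolding sent_until_def[abs_def] by (intro continuous_intros)

lemma sent_until_slot:
  assumes "t \<in> slot k" "k < m"
  shows "sent_until p i m t = (\<Sum>j<k. sent p i j * dur j) + sent p i k * (t - T k)"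
proof -
  have "sent_until p i m t = (\<Sum>j<Suc k. sent p i j * (max (T j) (min t (T (Suc j))) - T j))"
    unfolding sent_until_def
  proof (rule sum.mono_neutral_right)
    show "\<forall>j\<in>{..<m} - {..<Suc k}. sent p i j * (max (T j) (min t (T (Suc j))) - T j) = 0"
    proof
      fix j assume "j \<in> {..<m} - {..<Suc k}"
      then have "T (Suc k) \<le> T j"
        by (intro now_mono) auto
      then have "max (T j) (min t (T (Suc j))) = T j"
        using assms(1) by (auto simp: slot_def)
      then show "sent p i j * (max (T j) (min t (T (Suc j))) - T j) = 0"
        by simp
    qed
  qed (use assms(2) in auto)
  also have "\<dots> = (\<Sum>j<k. sent p i j * (max (T j) (min t (T (Suc j))) - T j)) +
      sent p i k * (max (T k) (min t (T (Suc k))) - T k)"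
    by simp
  also have "max (T k) (min t (T (Suc k))) = t"
    using assms(1) by (auto simp: slot_def)
  also have "(\<Sum>j<k. sent p i j * (max (T j) (min t (T (Suc j))) - T j)) = (\<Sum>j<k. sent p i j * dur j)"
  proof (rule sum.cong[OF refl])
    fix j assume "j \<in> {..<k}"
    then have "T (Suc j) \<le> T k"
      by (intro now_mono) auto
    then have "max (T j) (min t (T (Suc j))) = T (Suc j)"
      using assms(1) dur_nonneg[of j] by (auto simp: slot_def)
    then show "sent p i j * (max (T j) (min t (T (Suc j))) - T j) = sent p i j * dur j"
      by simp
  qed
  finally show ?thesis .
qed

lemma sent_until_end: "sent_until p i m (T m) = (\<Sum>j<m. sent p i j * dur j)"
  unfolding sent_until_def
proof (rule sum.cong[OF refl])
  fix j assume "j \<in> {..<m}"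
  then have "T (Suc j) \<le> T m"
    by (intro now_mono) auto
  then have "max (T j) (min (T m) (T (Suc j))) = T (Suc j)"
    using dur_nonneg[of j] by (auto simp: min_def max_def)
  then show "sent p i j * (max (T j) (min (T m) (T (Suc j))) - T j) = sent p i j * dur j"
    by simp
qed

lemma sent_until_start:
  assumes "t \<le> start (S c) p"
  shows "sent_until p (index (S c) p) (Suc c) t = 0"
  unfolding sent_until_def
proof (rule sum.neutral, rule ballI)
  fix k assume k: "k \<in> {..<Suc c}"
  show "sent p (index (S c) p) k * (max (T k) (min t (T (Suc k))) - T k) = 0"
  proof (cases "index (S k) p = index (S c) p")
    case True
    then have "start (S c) p \<le> T k"
      using start_eq[of k c p] k start_le[of k p] by auto
    then have "max (T k) (min t (T (Suc k))) = T k"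
      using assms by auto
    then show ?thesis by simp
  qed (simp add: sent_def)
qed

text \<open>Piece \<open>j\<close> is on the air only when at least \<open>j\<close> units of the
  transmission have been sent. For \<open>j = 0\<close> this is void, and the bound by
  \<open>start\<close> takes its place.\<close>

lemma transmitted_sent:
  assumes t: "t < T (Suc c)" "0 < rate (sched R) t" "transmitted (sched R) t = (p, j, index (S c) p)"
  shows "start (S c) p \<le> t" "real j \<le> sent_until p (index (S c) p) (Suc c) t"
proof -
  let ?i = "index (S c) p"
  obtain k where b: "busy R t k"
    using t(2) by (auto simp: sched_def split: if_splits)
  then have k: "t \<in> slot k" "waiting R (S k) \<noteq> {}"
    by (auto simp: busy_iff)
  have s: "p = fst (newest_waiting R (S k))" "?i = index (S k) p"
    "j = nat \<lfloor>progress (S k) p + speed R (S k) * (t - T k)\<rfloor>"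
    using sched_busy[OF b] t(3) by auto
  have "k \<le> c"
    using t(1) k(1) now_mono[of "Suc c" k R] by (force simp: slot_def not_le[symmetric])
  then show "start (S c) p \<le> t"
    using start_eq[of k c p] s(2) start_le[of k p] k(1) by (auto simp: slot_def)
  have "sent_until p ?i (Suc c) t = progress (S k) p + speed R (S k) * (t - T k)"
    using sent_until_slot[OF k(1), of "Suc c" p ?i] \<open>k \<le> c\<close> sum_sent[of k p ?i] s
    by (simp add: sent_def prate_def)
  then show "real j \<le> sent_until p ?i (Suc c) t"
    using s(3) piece_bounds(1)[OF k s(1)] by linarith
qed

lemma sent_le_rate:
  assumes k: "k \<le> c" "t \<in> slot k"
    and j: "real j \<le> sent_until p (index (S c) p) (Suc c) t" "sent_until p (index (S c) p) (Suc c) t < Suc j"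
    and pos: "sent p (index (S c) p) k \<noteq> 0"
  shows "rate (sched R) t = sent p (index (S c) p) k" "transmitted (sched R) t = (p, j, index (S c) p)"
proof -
  let ?i = "index (S c) p"
  have s: "p = fst (newest_waiting R (S k))" "index (S k) p = ?i" and w: "waiting R (S k) \<noteq> {}"
    using pos by (auto simp: sent_def prate_def speed_def split: if_splits)
  have b: "busy R t k"
    using k(2) w by (simp add: busy_iff)
  have "sent_until p ?i (Suc c) t = progress (S k) p + speed R (S k) * (t - T k)"
    using sent_until_slot[OF k(2), of "Suc c" p ?i] k(1) sum_sent[of k p ?i] s
    by (simp add: sent_def prate_def)
  then have "nat \<lfloor>progress (S k) p + speed R (S k) * (t - T k)\<rfloor> = j"
    using j by linarith
  then show "rate (sched R) t = sent p ?i k" "transmitted (sched R) t = (p, j, ?i)"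
    using sched_busy[OF b] s by (auto simp: sent_def prate_def)
qed

text \<open>While the amount sent is in the half-open interval from \<open>j\<close> to
  \<open>Suc j\<close>, the integer part in \<open>sched\<close> is \<open>j\<close>, so everything
  sent of this transmission is work on piece \<open>j\<close>.\<close>

lemma sent_work:
  assumes "a \<le> b" "0 \<le> a" "b \<le> T (Suc c)"
    and j: "\<And>t. a \<le> t \<Longrightarrow> t < b \<Longrightarrow> real j \<le> sent_until p (index (S c) p) (Suc c) t \<and>
      sent_until p (index (S c) p) (Suc c) t < Suc j"
  shows "ennreal (sent_until p (index (S c) p) (Suc c) b - sent_until p (index (S c) p) (Suc c) a)
    \<le> work (sched R) (p, j, index (S c) p) b"
proof -
  let ?i = "index (S c) p"
  let ?H = "sent_until p ?i (Suc c)"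
  let ?cl = "\<lambda>k x. max (T k) (min x (T (Suc k)))"
  have em: "emeasure lborel (slot k \<inter> {a..<b}) = ennreal (?cl k b - ?cl k a)" for k
  proof -
    have "slot k \<inter> {a..<b} = {max (T k) a..<min b (T (Suc k))}"
      by (auto simp: slot_def)
    then show ?thesis
      using assms(1) dur_nonneg[of k] by (cases "max (T k) a \<le> min b (T (Suc k))") (auto simp: min_def max_def)
  qed
  have "ennreal (?H b - ?H a) = ennreal (\<Sum>k<Suc c. sent p ?i k * (?cl k b - ?cl k a))"
    unfolding sent_until_def sum_subtractf[symmetric]
    by (rule arg_cong[where f = ennreal], rule sum.cong) (simp_all add: algebra_simps)
  also have "\<dots> = (\<Sum>k<Suc c. ennreal (sent p ?i k * (?cl k b - ?cl k a)))"
    using assms(1) sent_nonneg by (intro sum_ennreal[symmetric] mult_nonneg_nonneg) auto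
  also have "\<dots> = (\<Sum>k<Suc c. \<integral>\<^sup>+u. ennreal (sent p ?i k) * indicator (slot k \<inter> {a..<b}) u \<partial>lborel)"
  proof (rule sum.cong[OF refl])
    fix k
    have "slot k \<inter> {a..<b} \<in> sets lborel"
      by simp
    then have "(\<integral>\<^sup>+u. ennreal (sent p ?i k) * indicator (slot k \<inter> {a..<b}) u \<partial>lborel) =
        ennreal (sent p ?i k) * ennreal (?cl k b - ?cl k a)"
      by (simp only: nn_integral_cmult_indicator em)
    also have "\<dots> = ennreal (sent p ?i k * (?cl k b - ?cl k a))"
      using assms(1) sent_nonneg by (intro ennreal_mult[symmetric]) auto
    finally show "ennreal (sent p ?i k * (?cl k b - ?cl k a)) =
        (\<integral>\<^sup>+u. ennreal (sent p ?i k) * indicator (slot k \<inter> {a..<b}) u \<partial>lborel)"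
      by simp
  qed
  also have "\<dots> = (\<integral>\<^sup>+u. (\<Sum>k<Suc c. ennreal (sent p ?i k) * indicator (slot k \<inter> {a..<b}) u) \<partial>lborel)"
    by (intro nn_integral_sum[symmetric]) measurable
  also have "\<dots> \<le> work (sched R) (p, j, ?i) b"
    unfolding work_def
  proof (rule nn_integral_mono)
    fix u
    show "(\<Sum>k<Suc c. ennreal (sent p ?i k) * indicator (slot k \<inter> {a..<b}) u) \<le>
        ennreal (rate (sched R) u) * indicator {u. 0 \<le> u \<and> u \<le> b \<and> transmitted (sched R) u = (p, j, ?i)} u"
    proof (cases "\<exists>k<Suc c. u \<in> slot k \<inter> {a..<b} \<and> sent p ?i k \<noteq> 0")
      case True
      then obtain k where k: "k < Suc c" "u \<in> slot k" "a \<le> u" "u < b" "sent p ?i k \<noteq> 0"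
        by auto
      have "(\<Sum>k<Suc c. ennreal (sent p ?i k) * indicator (slot k \<inter> {a..<b}) u) =
          (\<Sum>k<Suc c. ennreal (sent p ?i k) * indicator (slot k) u)"
        using k by (intro sum.cong) (auto simp: indicator_def)
      also have "\<dots> = ennreal (sent p ?i k)"
        using k by (intro sum_slot) auto
      also have "\<dots> = ennreal (rate (sched R) u) * indicator {u. 0 \<le> u \<and> u \<le> b \<and> transmitted (sched R) u = (p, j, ?i)} u"
        using sent_le_rate[of k c u j p] j[OF k(3,4)] k assms(2) by simp
      finally show ?thesis by simp
    next
      case False
      then have "(\<Sum>k<Suc c. ennreal (sent p ?i k) * indicator (slot k \<inter> {a..<b}) u) = 0"
        by (intro sum.neutral) (auto simp: indicator_def)
      then show ?thesis
        by (simp only: zero_le)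
    qed
  qed
  finally show ?thesis .
qed

lemma served_satisfied:
  assumes r: "r \<in> served R (S c)"
  shows "satisfied_by \<sigma> (sched R) (fst r) (arrival R r) (T (Suc c))"
proof -
  define p where "p = fst r"
  define i where "i = index (S c) p"
  let ?a = "arrival R r"
  let ?H = "sent_until p i (Suc c)"
  have req: "r \<in> requests_of n R" and st: "?a \<le> start (S c) p" and aT: "?a \<le> T c"
    and full: "\<sigma> p \<le> progress (S c) p + prate R (S c) p * dur c"
    using r by (auto simp: served_def p_def arrived_requests_def)
  have a0: "0 \<le> ?a"
    by (rule arrival_nonneg[OF req])
  have mono: "?H x \<le> ?H y" if "x \<le> y" for x y
    using that by (rule sent_until_mono)
  have Ha: "?H t = 0" if "t \<le> start (S c) p" for t
    using sent_until_start[OF that] by (simp add: i_def)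
  have HT: "\<sigma> p \<le> ?H (T (Suc c))"
    unfolding sent_until_end using sum_sent[of c p i] full by (simp add: i_def sent_def)
  have "\<exists>x. x \<le> T (Suc c) \<and> ?H x = real j \<and> (\<forall>t<x. ?H t < j)" if "0 < j" "j \<le> \<sigma> p" for j :: nat
    using that HT Ha[OF st] by (intro first_time[where a = ?a] sent_until_continuous mono) auto
  then obtain x where x: "\<And>j :: nat. 0 < j \<Longrightarrow> j \<le> \<sigma> p \<Longrightarrow>
      x j \<le> T (Suc c) \<and> ?H (x j) = real j \<and> (\<forall>t<x j. ?H t < j)"
    by metis
  \<comment> \<open>\<open>satisfied_by\<close> requires the first moment to be the arrival. Nothing
    has been sent by then, since the request arrived no later than the start of the
    transmission.\<close>
  define v where "v j = (if j = 0 then ?a else x j)" for j :: nat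
  have Hv: "?H (v j) = j" "v j \<le> T (Suc c)" if "j \<le> \<sigma> p" for j
    using that x[of j] Ha[OF st] aT dur_nonneg[of c] by (auto simp: v_def)
  have below: "?H t < j" if "0 < j" "j \<le> \<sigma> p" "t < v j" for t j
    using that x[of j] by (auto simp: v_def)
  have less: "v j \<le> v (Suc j)" if "j < \<sigma> p" for j
  proof (rule ccontr)
    assume "\<not> v j \<le> v (Suc j)"
    then show False
      using mono[of "v (Suc j)" "v j"] Hv(1)[of j] Hv(1)[of "Suc j"] that by simp
  qed
  have ge: "?a \<le> v j" if "j \<le> \<sigma> p" for j
    using that
  proof (induction j)
    case 0
    then show ?case by (simp add: v_def)
  next
    case (Suc j)
    then show ?case using less[of j] by simp
  qed
  have zero: "work (sched R) (p, j, i) (v j) = 0" if j: "j < \<sigma> p" for j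
  proof -
    \<comment> \<open>At the moment \<open>v j\<close> itself piece \<open>j\<close> may already be
      on the air, but a single point has measure 0.\<close>
    have "work (sched R) (p, j, i) (v j) \<le> (\<integral>\<^sup>+u. \<infinity> * indicator {v j} u \<partial>lborel)"
      unfolding work_def
    proof (rule nn_integral_mono)
      fix u
      show "ennreal (rate (sched R) u) * indicator {u. 0 \<le> u \<and> u \<le> v j \<and> transmitted (sched R) u = (p, j, i)} u
          \<le> \<infinity> * indicator {v j} u"
      proof (cases "u < v j \<and> 0 < rate (sched R) u \<and> transmitted (sched R) u = (p, j, i)")
        case True
        then have "u < T (Suc c)"
          using Hv(2)[of j] j by simp
        then have "start (S c) p \<le> u" "real j \<le> ?H u"
          using transmitted_sent[of u c p j] True by (auto simp: i_def)
        then have False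
          using below[of j u] True j st by (cases "j = 0") (auto simp: v_def)
        then show ?thesis ..
      next
        case False
        then show ?thesis
          by (cases "u = v j") (auto simp: indicator_def not_less ennreal_neg)
      qed
    qed
    then show ?thesis
      by (simp add: nn_integral_cmult_indicator)
  qed
  have one: "1 \<le> work (sched R) (p, j, i) (v (Suc j))" if j: "j < \<sigma> p" for j
  proof -
    have "ennreal (?H (v (Suc j)) - ?H (v j)) \<le> work (sched R) (p, j, i) (v (Suc j))"
      unfolding i_def
    proof (rule sent_work)
      show "v j \<le> v (Suc j)" "0 \<le> v j" "v (Suc j) \<le> T (Suc c)"
        using less[OF j] ge[of j] a0 Hv(2)[of "Suc j"] j by auto
      fix t assume t: "v j \<le> t" "t < v (Suc j)"
      have "?H t < Suc j"
        using below[of "Suc j" t] t(2) j by simp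
      moreover have "real j \<le> ?H t"
        using mono[OF t(1)] Hv(1)[of j] j by simp
      ultimately show "real j \<le> sent_until p (index (S c) p) (Suc c) t \<and>
          sent_until p (index (S c) p) (Suc c) t < Suc j"
        by (simp add: i_def)
    qed
    moreover have "?H (v (Suc j)) - ?H (v j) = 1"
      using Hv(1)[of j] Hv(1)[of "Suc j"] j by simp
    ultimately show ?thesis
      by simp
  qed
  have "v 0 = ?a"
    by (simp add: v_def)
  then show ?thesis
    unfolding satisfied_by_def p_def[symmetric] using Hv(2)[of "\<sigma> p"] less zero one
    by (intro exI[of _ v] exI[of _ "\<lambda>_. i"]) auto
qed

section \<open>Flow time and energy of the real schedule\<close>

definition pending_cost :: real where
  "pending_cost = (\<Sum>k<last_step. dur k * card (pending R (S k)))"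

text \<open>From its arrival until the end of the step that serves it, the request is pending in
  every step, so the durations of these steps cover its flow time.\<close>

lemma completion_sched:
  assumes r: "r \<in> requests_of n R"
  shows "completion_time \<sigma> (sched R) (fst r) (arrival R r) - ereal (arrival R r) \<le>
    ereal (\<Sum>k<last_step. dur k * of_bool (r \<in> pending R (S k)))"
proof -
  have "r \<in> arrived_requests n R (T last_step)"
    using gaps_empty(3)[OF gaps_last_step] r by blast
  moreover have "pending R (S last_step) = {}"
    using gaps_empty(1,2)[OF gaps_last_step] alive_subset(1) by (auto simp: waiting_def)
  ultimately have ex: "r \<in> satisfied (S last_step)"
    unfolding pending_def by blast
  define f where "f = (LEAST k. r \<in> satisfied (S k))"
  have f: "r \<in> satisfied (S f)" "f \<le> last_step"
    unfolding f_def using ex by (auto intro: LeastI Least_le)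
  have before: "r \<notin> satisfied (S k)" if "k < f" for k
    using that not_less_Least unfolding f_def by blast
  obtain c where c: "f = Suc c"
    using f(1) by (cases f) auto
  then have served: "r \<in> served R (S c)"
    using f(1) before[of c] by auto
  then have ac: "arr_step r \<le> c"
    by (auto simp: served_def arrived_iff)
  have "completion_time \<sigma> (sched R) (fst r) (arrival R r) \<le> ereal (T f)"
    unfolding completion_time_def c by (intro INF_lower) (use served_satisfied[OF served] in simp)
  then have "completion_time \<sigma> (sched R) (fst r) (arrival R r) - ereal (arrival R r) \<le> ereal (T f) - ereal (arrival R r)"
    by (rule ereal_minus_mono) simp
  also have "\<dots> = ereal (T f - T (arr_step r))"
    by (simp add: T_arr_step[OF r])
  also have "T f - T (arr_step r) = (\<Sum>k=arr_step r..c. T (Suc k) - T k)"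
    using ac c by (subst sum_Suc_diff) auto
  also have "\<dots> = (\<Sum>k=arr_step r..c. dur k)"
    by simp
  also have "\<dots> = (\<Sum>k=arr_step r..c. dur k * of_bool (r \<in> pending R (S k)))"
  proof (rule sum.cong[OF refl])
    fix k assume "k \<in> {arr_step r..c}"
    then have "r \<in> pending R (S k)"
      using before[of k] c r by (auto simp: pending_def arrived_iff)
    then show "dur k = dur k * of_bool (r \<in> pending R (S k))"
      by simp
  qed
  also have "\<dots> \<le> (\<Sum>k<last_step. dur k * of_bool (r \<in> pending R (S k)))"
    using f(2) c dur_nonneg by (intro sum_mono2) auto
  finally show ?thesis
    by simp
qed

lemma total_flow_sched: "total_flow_time n \<sigma> R (sched R) \<le> ereal pending_cost"
proof -
  have "total_flow_time n \<sigma> R (sched R) =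
      (\<Sum>r\<in>requests_of n R. completion_time \<sigma> (sched R) (fst r) (arrival R r) - ereal (arrival R r))"
    unfolding total_flow_time_def arrival_def by (rule sum_requests_of[symmetric])
  also have "\<dots> \<le> (\<Sum>r\<in>requests_of n R. ereal (\<Sum>k<last_step. dur k * of_bool (r \<in> pending R (S k))))"
    by (intro sum_mono completion_sched)
  also have "\<dots> = ereal (\<Sum>r\<in>requests_of n R. \<Sum>k<last_step. dur k * of_bool (r \<in> pending R (S k)))"
    by simp
  also have "(\<Sum>r\<in>requests_of n R. \<Sum>k<last_step. dur k * of_bool (r \<in> pending R (S k))) =
      (\<Sum>k<last_step. dur k * (\<Sum>r\<in>requests_of n R. of_bool (r \<in> pending R (S k))))"
    by (subst sum.swap) (simp only: sum_distrib_left)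
  also have "\<dots> = pending_cost"
  proof -
    have "(\<Sum>r\<in>requests_of n R. of_bool (r \<in> pending R (S k)) :: real) = card (pending R (S k))" for k
    proof -
      have "requests_of n R \<inter> {r. r \<in> pending R (S k)} = pending R (S k)"
        by (auto simp: pending_def arrived_requests_def)
      then show ?thesis
        by (simp add: of_bool_def sum.If_cases)
    qed
    then show ?thesis
      by (simp add: pending_cost_def)
  qed
  finally show ?thesis .
qed

text \<open>While busy, the power equals the number of pending requests. It is an inequality because
  the server idles when all pending requests are still fractionally alive.\<close>

lemma energy_sched:
  assumes P: "P 0 = 0" "\<And>x. 0 \<le> x \<Longrightarrow> P (Q x) = x"
  shows "energy P (1 + \<epsilon>) (sched R) \<le> ennreal pending_cost"
proof -
  have "energy P (1 + \<epsilon>) (sched R) \<le>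
      (\<integral>\<^sup>+u. (\<Sum>k<last_step. ennreal (card (pending R (S k))) * indicator (slot k) u) \<partial>lborel)"
    unfolding energy_def
  proof (rule nn_integral_mono)
    fix u
    show "ennreal (P (rate (sched R) u / (1 + \<epsilon>))) * indicator {0..} u \<le>
        (\<Sum>k<last_step. ennreal (card (pending R (S k))) * indicator (slot k) u)"
    proof (cases "\<exists>k. busy R u k")
      case True
      then obtain k where k: "busy R u k" by blast
      then have "u \<in> slot k" "waiting R (S k) \<noteq> {}" "k < last_step"
        using busy_less_last by (auto simp: busy_iff)
      then have "(\<Sum>k<last_step. ennreal (card (pending R (S k))) * indicator (slot k) u) = card (pending R (S k))"
        by (subst sum_slot) (auto simp: ennreal_of_nat_eq_real_of_nat)
      moreover have "rate (sched R) u / (1 + \<epsilon>) = Q (card (pending R (S k)))"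
        using sched_busy[OF k] \<open>waiting R (S k) \<noteq> {}\<close> eps by (simp add: speed_def)
      ultimately show ?thesis
        using P(2) by (auto simp: indicator_def ennreal_of_nat_eq_real_of_nat)
    next
      case False
      then have "rate (sched R) u = 0"
        by (simp add: sched_def)
      then show ?thesis
        using P(1) by simp
    qed
  qed
  also have "\<dots> = (\<Sum>k<last_step. \<integral>\<^sup>+u. ennreal (card (pending R (S k))) * indicator (slot k) u \<partial>lborel)"
    by (rule nn_integral_sum) measurable
  also have "\<dots> = (\<Sum>k<last_step. ennreal (card (pending R (S k))) * ennreal (dur k))"
    by (intro sum.cong refl) (simp only: nn_integral_cmult_indicator slot_sets sets_lborel emeasure_slot)
  also have "\<dots> = (\<Sum>k<last_step. ennreal (dur k * card (pending R (S k))))"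
    using dur_nonneg by (intro sum.cong) (auto simp: ennreal_mult[symmetric] mult.commute)
  also have "\<dots> = ennreal pending_cost"
    unfolding pending_cost_def using dur_nonneg by (intro sum_ennreal) auto
  finally show ?thesis .
qed

end

section \<open>Competitiveness\<close>

context broadcast_comparison
begin

lemma total_flow_time_eq:
  "total_flow_time n \<sigma> R Z = enn2ereal (\<Sum>r\<in>requests_of n R. emeasure lborel (open_times r))"
proof -
  have "total_flow_time n \<sigma> R Z =
      (\<Sum>r\<in>requests_of n R. completion_time \<sigma> Z (fst r) (arrival R r) - ereal (arrival R r))"
    unfolding total_flow_time_def arrival_def by (rule sum_requests_of[symmetric])
  then show ?thesis
    by (simp add: open_times(2) flip: sum_enn2ereal)
qed

lemma alive_cost_le_objective: "ereal (\<epsilon>\<^sup>2 / 96 * alive_cost m) \<le> objective n \<sigma> P 1 R Z"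
proof -
  let ?F = "\<Sum>r\<in>requests_of n R. emeasure lborel (open_times r)"
  let ?E = "energy P 1 Z"
  have X: "0 \<le> alive_cost m"
    unfolding alive_cost_def using dur_nonneg by (intro sum_nonneg) auto
  have "ennreal (\<epsilon> / 6 * alive_cost m) \<le> ?E + ennreal (16 / \<epsilon>) * ?F"
    by (rule alive_cost_le)
  also have "\<dots> = 1 * ?E + ennreal (16 / \<epsilon>) * ?F"
    by simp
  \<comment> \<open>As 16 / \<epsilon> is at least 1, energy and flow time can carry the same
    factor; with the surplus \<epsilon> / 6 this makes 96 over the square of \<epsilon>.\<close>
  also have "\<dots> \<le> ennreal (16 / \<epsilon>) * ?E + ennreal (16 / \<epsilon>) * ?F"
    using eps by (intro add_right_mono mult_right_mono) auto
  finally have "ennreal (\<epsilon> / 16) * ennreal (\<epsilon> / 6 * alive_cost m) \<le>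
      ennreal (\<epsilon> / 16) * (ennreal (16 / \<epsilon>) * (?F + ?E))"
    by (intro mult_left_mono) (simp_all add: distrib_left add.commute)
  moreover have "ennreal (\<epsilon> / 16) * ennreal (\<epsilon> / 6 * alive_cost m) = ennreal (\<epsilon>\<^sup>2 / 96 * alive_cost m)"
    using eps X by (simp add: ennreal_mult[symmetric] power2_eq_square)
  moreover have "ennreal (\<epsilon> / 16) * (ennreal (16 / \<epsilon>) * (?F + ?E)) = ?F + ?E"
    using eps by (simp add: mult.assoc[symmetric] ennreal_mult[symmetric])
  ultimately have "ennreal (\<epsilon>\<^sup>2 / 96 * alive_cost m) \<le> ?F + ?E"
    by simp
  then have "enn2ereal (ennreal (\<epsilon>\<^sup>2 / 96 * alive_cost m)) \<le> enn2ereal (?F + ?E)"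
    by (simp add: less_eq_ennreal.rep_eq)
  moreover have "0 \<le> \<epsilon>\<^sup>2 / 96 * alive_cost m"
    using X by simp
  ultimately show ?thesis
    by (simp add: objective_def total_flow_time_eq plus_ennreal.rep_eq)
qed

end

text \<open>Flow time and energy are each at most \<open>pending_cost\<close>, hence twice the
  factor 3 / \<epsilon> of \<open>sum_pending_le\<close>.\<close>

lemma (in broadcast_run) objective_sched:
  assumes P: "P 0 = 0" "\<And>x. 0 \<le> x \<Longrightarrow> P (Q x) = x"
  shows "objective n \<sigma> P (1 + \<epsilon>) R (sched R) \<le> ereal (6 / \<epsilon> * alive_cost last_step)"
proof -
  have "0 \<le> pending_cost"
    unfolding pending_cost_def using dur_nonneg by (intro sum_nonneg) auto
  then have "enn2ereal (energy P (1 + \<epsilon>) (sched R)) \<le> ereal pending_cost"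
    using energy_sched[OF P] by (metis enn2ereal_ennreal less_eq_ennreal.rep_eq)
  then have "objective n \<sigma> P (1 + \<epsilon>) R (sched R) \<le> ereal pending_cost + ereal pending_cost"
    unfolding objective_def by (intro add_mono total_flow_sched)
  also have "\<dots> \<le> ereal (6 / \<epsilon> * alive_cost last_step)"
    using sum_pending_le[of last_step] by (simp add: pending_cost_def alive_cost_def)
  finally show ?thesis .
qed

lemma broadcast_power_inverse:
  assumes "power_function P" "\<forall>p<n. 0 < \<sigma> p" "0 < \<epsilon>" "\<epsilon> \<le> 1"
  shows "broadcast n \<sigma> (power_inverse P) \<epsilon>"
  using assms power_inverse power_inverse_pos power_inverse_mono power_inverse_ratio_mono
  by unfold_locales auto

text \<open>As \<open>opt\<close> is an infimum, the lower bound is proved against every feasible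
  \<open>Z\<close>; \<open>alive_cost\<close> does not depend on \<open>Z\<close>, and the factors 6
  / \<epsilon> and 96 over the square of \<epsilon> multiply to the constant.\<close>

lemma broadcast_competitive:
  assumes P: "power_function P" and \<sigma>: "\<forall>p<n. 0 < \<sigma> p" and \<epsilon>: "0 < \<epsilon>" "\<epsilon> \<le> 1"
  shows "competitive n \<sigma> P (1 + \<epsilon>) (576 / \<epsilon> ^ 3) (broadcast.sched n \<sigma> (power_inverse P) \<epsilon>)"
  unfolding competitive_def
proof (intro allI impI)
  fix R assume R: "request_sequence n R"
  interpret broadcast n \<sigma> "power_inverse P" \<epsilon>
    by (rule broadcast_power_inverse[OF P \<sigma> \<epsilon>])
  interpret broadcast_run n \<sigma> "power_inverse P" \<epsilon> R
    by unfold_locales (rule R)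
  let ?X = "alive_cost last_step"
  have "ereal (\<epsilon>\<^sup>2 / 96 * ?X) \<le> opt n \<sigma> P R"
    unfolding opt_def
  proof (rule INF_greatest)
    fix Z assume "Z \<in> {S. feasible n \<sigma> S}"
    then interpret broadcast_comparison n \<sigma> "power_inverse P" \<epsilon> R P Z
      using P power_function_nonneg[OF P] power_inverse_ratio_bound[OF P]
      by unfold_locales (auto simp: power_function_def)
    show "ereal (\<epsilon>\<^sup>2 / 96 * ?X) \<le> objective n \<sigma> P 1 R Z"
      by (rule alive_cost_le_objective)
  qed
  then have "ereal (576 / \<epsilon> ^ 3) * ereal (\<epsilon>\<^sup>2 / 96 * ?X) \<le> ereal (576 / \<epsilon> ^ 3) * opt n \<sigma> P R"
    using \<epsilon> by (intro ereal_mult_left_mono) auto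
  moreover have "ereal (576 / \<epsilon> ^ 3) * ereal (\<epsilon>\<^sup>2 / 96 * ?X) = ereal (6 / \<epsilon> * ?X)"
    using \<epsilon> by (simp add: power2_eq_square power3_eq_cube)
  moreover have "objective n \<sigma> P (1 + \<epsilon>) R (sched R) \<le> ereal (6 / \<epsilon> * ?X)"
    by (rule objective_sched) (use power_function_zero[OF P] power_inverse(2)[OF P] in auto)
  ultimately show "objective n \<sigma> P (1 + \<epsilon>) R (sched R) \<le> ereal (576 / \<epsilon> ^ 3) * opt n \<sigma> P R"
    by simp
qed

lemma broadcast_online:
  assumes P: "power_function P" and \<sigma>: "\<forall>p<n. 0 < \<sigma> p" and \<epsilon>: "0 < \<epsilon>" "\<epsilon> \<le> 1"
  shows "online_algorithm n \<sigma> (broadcast.sched n \<sigma> (power_inverse P) \<epsilon>)"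
proof -
  interpret broadcast n \<sigma> "power_inverse P" \<epsilon>
    by (rule broadcast_power_inverse[OF P \<sigma> \<epsilon>])
  have "feasible n \<sigma> (sched R)" if "request_sequence n R" for R
  proof -
    interpret broadcast_run n \<sigma> "power_inverse P" \<epsilon> R
      by unfold_locales (rule that)
    show ?thesis by (rule sched_feasible)
  qed
  then show ?thesis
    unfolding online_algorithm_def using sched_agree agreeI by blast
qed

theorem theorem1:
  shows "\<exists>C>0. \<forall>\<epsilon>::real. 0 < \<epsilon> \<longrightarrow> \<epsilon> \<le> 1 \<longrightarrow>
    (\<exists>A :: (real \<Rightarrow> real) \<Rightarrow> nat \<Rightarrow> (nat \<Rightarrow> nat) \<Rightarrow> requests \<Rightarrow> schedule.
      \<forall>P n \<sigma>. power_function P \<longrightarrow> (\<forall>p<n. 0 < \<sigma> p) \<longrightarrow>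
        online_algorithm n \<sigma> (A P n \<sigma>) \<and>
        competitive n \<sigma> P (1 + \<epsilon>) (C / \<epsilon> ^ 3) (A P n \<sigma>))"
proof (intro exI[of _ "576 :: real"] conjI allI impI)
  fix \<epsilon> :: real assume \<epsilon>: "0 < \<epsilon>" "\<epsilon> \<le> 1"
  show "\<exists>A :: (real \<Rightarrow> real) \<Rightarrow> nat \<Rightarrow> (nat \<Rightarrow> nat) \<Rightarrow> requests \<Rightarrow> schedule.
      \<forall>P n \<sigma>. power_function P \<longrightarrow> (\<forall>p<n. 0 < \<sigma> p) \<longrightarrow>
        online_algorithm n \<sigma> (A P n \<sigma>) \<and>
        competitive n \<sigma> P (1 + \<epsilon>) (576 / \<epsilon> ^ 3) (A P n \<sigma>)"
    by (intro exI[of _ "\<lambda>P n \<sigma>. broadcast.sched n \<sigma> (power_inverse P) \<epsilon>"])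
      (use broadcast_online broadcast_competitive \<epsilon> in blast)
qed simp

end
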